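(* Let $(M^n,g)$ be a Ricci flat Riemannian manifold with $n=\dim M\ge 2$ and scalar curvature $r$, let $f>0$ be a smooth function on $M$, and let $\tilde M = M\times_f \mathbb{R}$, with metric $\tilde g=g-f^2dt^2$, be a static perfect fluid spacetime. Let $(\tilde g,\tilde\lambda,\tilde\phi)$ be an almost gradient Ricci soliton on $\tilde M$ with $H^\phi=0$ on $M$, where $\phi=\tilde\phi|_M$. Then $\tilde M$ satisfies the strong energy condition if $$\tilde\lambda\le\frac{r}{n-1}.$$
   Context: The static spacetime $M\times_f\mathbb{R}$ is $M\times\mathbb{R}$ with the Lorentzian metric $\tilde g=g-f^2dt^2$, $t$ being the coordinate on $\mathbb{R}$. It is a static perfect fluid (SPF) spacetime with isotropic pressure $\rho$ (a smooth function) if, with $S$, $r$ the Ricci tensor and scalar curvature of $(M,g)$ and $H^f,\triangle f$ the Hessian and Laplacian (trace of the Hessian) of $f$ on $(M,g)$, $$f\Big(S-\frac rn g\Big)=H^f-\frac{\triangle f}{n}g,\qquad \triangle f=\Big(\frac{n-2}{2(n-1)}r+\frac{n}{n-1}\rho\Big)f .$$ An almost gradient Ricci soliton $(\tilde g,\tilde\lambda,\tilde\phi)$ on $\tilde M$ consists of smooth functions $\tilde\phi,\tilde\lambda$ on $\tilde M$ with $H^{\tilde\phi}+\tilde S+\tilde\lambda\tilde g=0$, where $H^{\tilde\phi}$ is the Hessian of $\tilde\phi$ with respect to $\tilde g$ and $\tilde S$ is the Ricci tensor of $\tilde g$. $M$ is identified with a slice $M\times\{t_0\}$, and $\tilde\phi|_M$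 is the restriction to this slice; $H^\phi$ is its Hessian on $(M,g)$. Strong energy condition: $\tilde S(v,v)\ge 0$ for every timelike tangent vector $v$ of $\tilde M$. *)

theory Defs
  imports "HOL-Analysis.Analysis"
begin

section \<open>Smooth manifolds\<close>

primrec Ck_on :: "nat \<Rightarrow> ('a::real_normed_vector \<Rightarrow> 'b::real_normed_vector) \<Rightarrow> 'a set \<Rightarrow> bool" where
  "Ck_on 0 F S \<longleftrightarrow> continuous_on S F"
| "Ck_on (Suc k) F S \<longleftrightarrow>
     (\<forall>y\<in>S. F differentiable (at y)) \<and> (\<forall>u. Ck_on k (\<lambda>y. frechet_derivative F (at y) u) S)"

text \<open>Only used on open subsets of finite-dimensional spaces, where it is \<open>C\<^sup>\<infinity>\<close>.\<close>

definition smooth_on :: "('a::real_normed_vector \<Rightarrow> 'b::real_normed_vector) \<Rightarrow> 'a set \<Rightarrow> bool" where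
  "smooth_on F S \<longleftrightarrow> (\<forall>k. Ck_on k F S)"

text \<open>A chart is a pair of its domain and its coordinate map. The underlying set of a manifold is
  the whole type \<open>'m\<close>, its dimension is \<open>DIM('e)\<close>, and the atlas is an indexed family of charts.\<close>

type_synonym ('m, 'e) chart = "'m set \<times> ('m \<Rightarrow> 'e)"
type_synonym ('i, 'm, 'e) atlas = "'i \<Rightarrow> ('m, 'e) chart"

abbreviation chart_dom :: "('m, 'e) chart \<Rightarrow> 'm set" where
  "chart_dom c \<equiv> fst c"

abbreviation coord :: "('m, 'e) chart \<Rightarrow> 'm \<Rightarrow> 'e" where
  "coord c \<equiv> snd c"

definition chart_im :: "('m, 'e) chart \<Rightarrow> 'e set" where
  "chart_im c = coord c ` chart_dom c"

definition chart_inv :: "('m, 'e) chart \<Rightarrow> 'e \<Rightarrow> 'm" where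
  "chart_inv c = inv_into (chart_dom c) (coord c)"

definition smooth_manifold ::
    "('i, 'm::{t2_space, second_countable_topology}, 'e::euclidean_space) atlas \<Rightarrow> bool" where
  "smooth_manifold A \<longleftrightarrow>
     (\<Union>i. chart_dom (A i)) = UNIV \<and>
     (\<forall>i. open (chart_dom (A i)) \<and> open (chart_im (A i)) \<and>
          homeomorphism (chart_dom (A i)) (chart_im (A i)) (coord (A i)) (chart_inv (A i))) \<and>
     (\<forall>i j. smooth_on (coord (A j) \<circ> chart_inv (A i))
              (coord (A i) ` (chart_dom (A i) \<inter> chart_dom (A j))))"

definition smooth_function ::
    "('i, 'm, 'e::euclidean_space) atlas \<Rightarrow> ('m \<Rightarrow> real) \<Rightarrow> bool" where
  "smooth_function A F \<longleftrightarrow> (\<forall>i. smooth_on (F \<circ> chart_inv (A i)) (chart_im (A i)))"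

text \<open>A tangent vector at \<open>p\<close> is represented in a chart \<open>i\<close> around \<open>p\<close> by a vector \<open>u :: 'e\<close>; the
  representatives in charts \<open>i\<close> and \<open>j\<close> are related by the derivative of the coordinate change.
  A covariant 2-tensor field \<open>T\<close> is given by its values \<open>T i p u v\<close> on such representatives.\<close>

type_synonym ('i, 'm, 'e) tensor2 = "'i \<Rightarrow> 'm \<Rightarrow> 'e \<Rightarrow> 'e \<Rightarrow> real"

definition coord_change ::
    "('i, 'm, 'e::euclidean_space) atlas \<Rightarrow> 'i \<Rightarrow> 'i \<Rightarrow> 'm \<Rightarrow> 'e \<Rightarrow> 'e" where
  "coord_change A i j p =
     frechet_derivative (coord (A j) \<circ> chart_inv (A i)) (at (coord (A i) p))"

definition smooth_tensor2 ::
    "('i, 'm, 'e::euclidean_space) atlas \<Rightarrow> ('i, 'm, 'e) tensor2 \<Rightarrow> bool" where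
  "smooth_tensor2 A T \<longleftrightarrow>
     (\<forall>i. \<forall>p\<in>chart_dom (A i). bilinear (T i p)) \<and>
     (\<forall>i j. \<forall>p\<in>chart_dom (A i) \<inter> chart_dom (A j). \<forall>u v.
        T i p u v = T j p (coord_change A i j p u) (coord_change A i j p v)) \<and>
     (\<forall>i u v. smooth_on (\<lambda>y. T i (chart_inv (A i) y) u v) (chart_im (A i)))"

definition pseudo_riemannian_metric ::
    "('i, 'm, 'e::euclidean_space) atlas \<Rightarrow> ('i, 'm, 'e) tensor2 \<Rightarrow> bool" where
  "pseudo_riemannian_metric A g \<longleftrightarrow> smooth_tensor2 A g \<and>
     (\<forall>i. \<forall>p\<in>chart_dom (A i).
        (\<forall>u v. g i p u v = g i p v u) \<and> (\<forall>u. (\<forall>v. g i p u v = 0) \<longrightarrow> u = 0))"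

definition riemannian_metric ::
    "('i, 'm, 'e::euclidean_space) atlas \<Rightarrow> ('i, 'm, 'e) tensor2 \<Rightarrow> bool" where
  "riemannian_metric A g \<longleftrightarrow> pseudo_riemannian_metric A g \<and>
     (\<forall>i. \<forall>p\<in>chart_dom (A i). \<forall>u. u \<noteq> 0 \<longrightarrow> 0 < g i p u u)"


section \<open>Curvature and Hessian in coordinates\<close>

text \<open>Here \<open>G y\<close> is the metric at the coordinate point \<open>y\<close>; arguments \<open>u, v, w\<close> are constant
  (coordinate) vector fields, so brackets vanish and \<open>christoffel G y u v\<close> is the Levi-Civita
  derivative \<open>\<nabla>\<^sub>u v\<close>, given by the Koszul formula.\<close>

definition christoffel :: "('e \<Rightarrow> 'e \<Rightarrow> 'e \<Rightarrow> real) \<Rightarrow> 'e \<Rightarrow> 'e \<Rightarrow> 'e \<Rightarrow> 'e::euclidean_space" where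
  "christoffel G y u v = (THE w. \<forall>z. 2 * G y w z =
      frechet_derivative (\<lambda>y'. G y' v z) (at y) u
    + frechet_derivative (\<lambda>y'. G y' u z) (at y) v
    - frechet_derivative (\<lambda>y'. G y' u v) (at y) z)"

definition coord_hessian ::
    "('e \<Rightarrow> 'e \<Rightarrow> 'e \<Rightarrow> real) \<Rightarrow> ('e \<Rightarrow> real) \<Rightarrow> 'e \<Rightarrow> 'e \<Rightarrow> 'e::euclidean_space \<Rightarrow> real" where
  "coord_hessian G F y u v =
      frechet_derivative (\<lambda>y'. frechet_derivative F (at y') v) (at y) u
    - frechet_derivative F (at y) (christoffel G y u v)"

text \<open>\<open>R(u,v)w = \<nabla>\<^sub>u \<nabla>\<^sub>v w - \<nabla>\<^sub>v \<nabla>\<^sub>u w\<close>.\<close>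

definition coord_riemann ::
    "('e \<Rightarrow> 'e \<Rightarrow> 'e \<Rightarrow> real) \<Rightarrow> 'e \<Rightarrow> 'e \<Rightarrow> 'e \<Rightarrow> 'e \<Rightarrow> 'e::euclidean_space" where
  "coord_riemann G y u v w =
      frechet_derivative (\<lambda>y'. christoffel G y' v w) (at y) u
    - frechet_derivative (\<lambda>y'. christoffel G y' u w) (at y) v
    + christoffel G y u (christoffel G y v w)
    - christoffel G y v (christoffel G y u w)"

definition lin_trace :: "('e::euclidean_space \<Rightarrow> 'e) \<Rightarrow> real" where
  "lin_trace L = (\<Sum>b\<in>Basis. L b \<bullet> b)"

text \<open>The sign convention makes the Ricci tensor of a round sphere positive.\<close>

definition coord_ricci ::
    "('e \<Rightarrow> 'e \<Rightarrow> 'e \<Rightarrow> real) \<Rightarrow> 'e \<Rightarrow> 'e \<Rightarrow> 'e::euclidean_space \<Rightarrow> real" where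
  "coord_ricci G y v w = lin_trace (\<lambda>u. coord_riemann G y u v w)"

text \<open>The trace of a bilinear form \<open>T\<close> with respect to the inner product \<open>h\<close>, i.e. the trace of the
  endomorphism \<open>L\<close> with \<open>h (L u) z = T u z\<close>.\<close>

definition metric_trace ::
    "('e::euclidean_space \<Rightarrow> 'e \<Rightarrow> real) \<Rightarrow> ('e \<Rightarrow> 'e \<Rightarrow> real) \<Rightarrow> real" where
  "metric_trace h T = lin_trace (\<lambda>u. THE w. \<forall>z. h w z = T u z)"


section \<open>Curvature and Hessian on a manifold\<close>

text \<open>All quantities below are evaluated at a point \<open>p\<close> by means of a chart \<open>i\<close> around \<open>p\<close>. The
  Hessian and the Ricci tensor are tensor fields; the Laplacian and the scalar curvature are scalars
  and do not depend on the choice of \<open>i\<close>.\<close>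

definition coord_metric ::
    "('i, 'm, 'e) atlas \<Rightarrow> ('i, 'm, 'e) tensor2 \<Rightarrow> 'i \<Rightarrow> 'e \<Rightarrow> 'e \<Rightarrow> 'e \<Rightarrow> real" where
  "coord_metric A g i y = g i (chart_inv (A i) y)"

definition hessian ::
    "('i, 'm, 'e::euclidean_space) atlas \<Rightarrow> ('i, 'm, 'e) tensor2 \<Rightarrow> ('m \<Rightarrow> real) \<Rightarrow>
     ('i, 'm, 'e) tensor2" where
  "hessian A g F i p =
     coord_hessian (coord_metric A g i) (F \<circ> chart_inv (A i)) (coord (A i) p)"

definition ricci ::
    "('i, 'm, 'e::euclidean_space) atlas \<Rightarrow> ('i, 'm, 'e) tensor2 \<Rightarrow> ('i, 'm, 'e) tensor2" where
  "ricci A g i p = coord_ricci (coord_metric A g i) (coord (A i) p)"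

definition laplacian ::
    "('i, 'm, 'e::euclidean_space) atlas \<Rightarrow> ('i, 'm, 'e) tensor2 \<Rightarrow> ('m \<Rightarrow> real) \<Rightarrow> 'i \<Rightarrow> 'm \<Rightarrow> real" where
  "laplacian A g F i p = metric_trace (g i p) (hessian A g F i p)"

definition scalar_curvature ::
    "('i, 'm, 'e::euclidean_space) atlas \<Rightarrow> ('i, 'm, 'e) tensor2 \<Rightarrow> 'i \<Rightarrow> 'm \<Rightarrow> real" where
  "scalar_curvature A g i p = metric_trace (g i p) (ricci A g i p)"

definition zero_tensor2 :: "('i, 'm, 'e) atlas \<Rightarrow> ('i, 'm, 'e) tensor2 \<Rightarrow> bool" where
  "zero_tensor2 A T \<longleftrightarrow> (\<forall>i. \<forall>p\<in>chart_dom (A i). \<forall>u v. T i p u v = 0)"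

definition ricci_flat ::
    "('i, 'm, 'e::euclidean_space) atlas \<Rightarrow> ('i, 'm, 'e) tensor2 \<Rightarrow> bool" where
  "ricci_flat A g \<longleftrightarrow> zero_tensor2 A (ricci A g)"

definition almost_gradient_ricci_soliton ::
    "('i, 'm, 'e::euclidean_space) atlas \<Rightarrow> ('i, 'm, 'e) tensor2 \<Rightarrow> ('m \<Rightarrow> real) \<Rightarrow> ('m \<Rightarrow> real) \<Rightarrow> bool" where
  "almost_gradient_ricci_soliton A g lam phi \<longleftrightarrow>
     smooth_function A lam \<and> smooth_function A phi \<and>
     zero_tensor2 A (\<lambda>i p u v. hessian A g phi i p u v + ricci A g i p u v + lam p * g i p u v)"

definition strong_energy_condition ::
    "('i, 'm, 'e::euclidean_space) atlas \<Rightarrow> ('i, 'm, 'e) tensor2 \<Rightarrow> bool" where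
  "strong_energy_condition A g \<longleftrightarrow>
     (\<forall>i. \<forall>p\<in>chart_dom (A i). \<forall>v. g i p v v < 0 \<longrightarrow> 0 \<le> ricci A g i p v v)"


section \<open>Static spacetimes\<close>

text \<open>The manifold \<open>M \<times> \<real>\<close>, with the product charts \<open>(p, t) \<mapsto> (x p, t)\<close>.\<close>

definition static_atlas :: "('i, 'm, 'e) atlas \<Rightarrow> ('i, 'm \<times> real, 'e \<times> real) atlas" where
  "static_atlas A i = (chart_dom (A i) \<times> UNIV, map_prod (coord (A i)) id)"

text \<open>The metric \<open>g - f\<^sup>2 dt\<^sup>2\<close>.\<close>

definition static_metric ::
    "('i, 'm, 'e) tensor2 \<Rightarrow> ('m \<Rightarrow> real) \<Rightarrow> ('i, 'm \<times> real, 'e \<times> real) tensor2" where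
  "static_metric g f i q v w =
     g i (fst q) (fst v) (fst w) - (f (fst q))\<^sup>2 * (snd v * snd w)"

definition static_perfect_fluid ::
    "('i, 'm, 'e::euclidean_space) atlas \<Rightarrow> ('i, 'm, 'e) tensor2 \<Rightarrow> ('m \<Rightarrow> real) \<Rightarrow> ('m \<Rightarrow> real) \<Rightarrow> bool" where
  "static_perfect_fluid A g f rho \<longleftrightarrow> (let n = real DIM('e) in
     smooth_function A rho \<and>
     (\<forall>i. \<forall>p\<in>chart_dom (A i).
        (\<forall>u v. f p * (ricci A g i p u v - scalar_curvature A g i p / n * g i p u v) =
               hessian A g f i p u v - laplacian A g f i p / n * g i p u v) \<and>
        laplacian A g f i p =
          ((n - 2) / (2 * (n - 1)) * scalar_curvature A g i p + n / (n - 1) * rho p) * f p))"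

end

theory Submission
  imports Defs
begin

text \<open>The spacetime turns out to be Ricci flat, so that the strong energy condition holds with equality.

  Since \<open>S = 0\<close>, the fluid equation says \<open>H\<^sup>f = h g\<close> with \<open>h = \<triangle>f / n\<close>. Writing \<open>\<nabla>\<^sub>u\<nabla>f = h u\<close>
  and commuting covariant derivatives gives \<open>R(z,u)\<nabla>f = dh(z) u - dh(u) z\<close>, whose trace is
  \<open>Ric(v,\<nabla>f) = (1 - n) dh(v)\<close>. Hence \<open>dh = 0\<close> (\<open>factor_deriv\<close>). The warped product formulas, with
  \<open>V = v + b \<partial>\<^sub>t\<close> and \<open>W = w + c \<partial>\<^sub>t\<close>, become
  \<open>Ric~(V,W) = Ric(v,w) + n b c f h - (h / f) g(v,w)\<close> (\<open>static_ricci\<close>), so the goal is \<open>h = 0\<close>.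

  This is where the soliton enters, and it must be used at all times, not only on the slice \<open>t\<^sub>0\<close>
  (\<open>factor_zero\<close>). Work near a point. The mixed components of the soliton equation say that
  \<open>\<partial>\<^sub>t\<phi> / f\<close> does not depend on the point of \<open>M\<close>, so \<open>\<phi> = b(t) f + \<phi>\<^sub>0\<close> with \<open>\<phi>\<^sub>0\<close> the restriction to
  the slice and \<open>b(t\<^sub>0) = 0\<close>. As \<open>H\<^sup>\<phi>\<^sub>0 = 0\<close>, the spatial components give \<open>\<lambda> = h / f - b h\<close>, and then
  the time component is the scalar equation
  \<open>b'' - b |\<nabla>f|\<^sup>2 - \<langle>\<nabla>f,\<nabla>\<phi>\<^sub>0\<rangle> + (n - 1) h + b h f = 0\<close>.
  Its derivative along \<open>M\<close> is \<open>h (b df + d\<phi>\<^sub>0) = 0\<close>. If \<open>h\<close> were not zero, time \<open>t\<^sub>0\<close> would give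
  \<open>d\<phi>\<^sub>0 = 0\<close>; since \<open>H\<^sup>f = h g\<close> prevents \<open>df\<close> from vanishing on an open set, \<open>b\<close> would vanish at all
  times, and the scalar equation would reduce to \<open>(n - 1) h = 0\<close>, a contradiction.

  Everything is local, so the argument is carried out in the image of one chart. Three facts of
  analysis support it: second derivatives commute (\<open>dir_deriv_commute\<close>), the solution of a smoothly
  varying invertible linear system is smooth (\<open>smooth_on_inv_linear_family\<close>), which makes the Christoffel
  map and the gradient smooth, and the product rule for a varying linear map applied to a vector field
  (\<open>dir_deriv_linear_family\<close>).\<close>

section \<open>Calculus of smooth maps on open sets\<close>

abbreviation dir_deriv :: "('a::real_normed_vector \<Rightarrow> 'b::real_normed_vector) \<Rightarrow> 'a \<Rightarrow> 'a \<Rightarrow> 'b" where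
  "dir_deriv F y \<equiv> frechet_derivative F (at y)"

lemma has_dir_deriv: "F differentiable (at y) \<Longrightarrow> (F has_derivative dir_deriv F y) (at y)"
  by (simp add: frechet_derivative_works)

lemma dir_deriv_eq: "(F has_derivative F') (at y) \<Longrightarrow> dir_deriv F y u = F' u"
  by (metis frechet_derivative_at)

lemma linear_dir_deriv: "F differentiable (at y) \<Longrightarrow> linear (dir_deriv F y)"
  by (simp add: linear_frechet_derivative)

lemma dir_deriv_cong:
  assumes "open S" "y \<in> S" "\<And>x. x \<in> S \<Longrightarrow> F x = G x"
  shows "dir_deriv F y = dir_deriv G y"
proof -
  have "(F has_derivative D) (at y) \<longleftrightarrow> (G has_derivative D) (at y)" for D
    using assms by (metis has_derivative_transform_within_open)
  then show ?thesis by (simp add: frechet_derivative_def)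
qed

lemma differentiable_cong_open:
  assumes "open S" "y \<in> S" "\<And>x. x \<in> S \<Longrightarrow> F x = G x"
  shows "F differentiable (at y) \<longleftrightarrow> G differentiable (at y)"
  using assms by (metis has_derivative_transform_within_open differentiable_def)

lemma Ck_on_cong:
  assumes "open S" "\<And>x. x \<in> S \<Longrightarrow> F x = G x"
  shows "Ck_on k F S \<longleftrightarrow> Ck_on k G S"
  using assms(2)
proof (induction k arbitrary: F G)
  case 0
  then show ?case by (simp cong: continuous_on_cong)
next
  case (Suc k)
  have "Ck_on k (\<lambda>y. dir_deriv F y u) S \<longleftrightarrow> Ck_on k (\<lambda>y. dir_deriv G y u) S" for u
    by (rule Suc.IH) (use dir_deriv_cong[OF assms(1)] Suc.prems in metis)
  moreover have "F differentiable (at y) \<longleftrightarrow> G differentiable (at y)" if "y \<in> S" for y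
    using differentiable_cong_open[OF assms(1) that] Suc.prems by blast
  ultimately show ?case by simp
qed

lemma Ck_on_continuous: "Ck_on k F S \<Longrightarrow> continuous_on S F"
  by (cases k) (auto simp: differentiable_imp_continuous_within intro!: continuous_at_imp_continuous_on)

lemma Ck_on_Suc_imp: "Ck_on (Suc k) F S \<Longrightarrow> Ck_on k F S"
proof (induction k arbitrary: F)
  case 0
  show ?case using Ck_on_continuous[OF 0] by (simp only: Ck_on.simps)
next
  case (Suc k)
  have "Ck_on k (\<lambda>y. dir_deriv F y u) S" for u
    using Suc.prems by (intro Suc.IH) simp
  then show ?case using Suc.prems by simp
qed

text \<open>The definition of \<open>Ck_on\<close> speaks of the derivative operator itself; in practice a derivative is
  known by an explicit formula that is valid on \<open>S\<close> only. Openness of \<open>S\<close> bridges the gap.\<close>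

lemma Ck_on_SucI:
  assumes S: "open S" and F: "\<And>y. y \<in> S \<Longrightarrow> (F has_derivative F' y) (at y)"
    and F': "\<And>u. Ck_on k (\<lambda>y. F' y u) S"
  shows "Ck_on (Suc k) F S"
proof -
  have "Ck_on k (\<lambda>y. dir_deriv F y u) S" for u
    using F'[of u] by (subst Ck_on_cong[OF S]) (auto simp: dir_deriv_eq[OF F])
  then show ?thesis using F by (auto simp: differentiable_def)
qed

lemma Ck_on_has_derivative:
  "Ck_on (Suc k) F S \<Longrightarrow> y \<in> S \<Longrightarrow> (F has_derivative dir_deriv F y) (at y)"
  by (simp add: has_dir_deriv)

lemma Ck_on_const: "open S \<Longrightarrow> Ck_on k (\<lambda>y. c) S"
  by (induction k arbitrary: c) simp_all

lemma Ck_on_add: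
  assumes S: "open S" and "Ck_on k F S" "Ck_on k G S"
  shows "Ck_on k (\<lambda>y. F y + G y) S"
  using assms(2,3)
proof (induction k arbitrary: F G)
  case 0
  then show ?case by (simp add: continuous_on_add)
next
  case (Suc k)
  show ?case
  proof (rule Ck_on_SucI[OF S])
    show "((\<lambda>y. F y + G y) has_derivative (\<lambda>u. dir_deriv F y u + dir_deriv G y u)) (at y)"
      if "y \<in> S" for y
      using Suc.prems that by (intro has_derivative_add Ck_on_has_derivative)
    show "Ck_on k (\<lambda>y. dir_deriv F y u + dir_deriv G y u) S" for u
      using Suc by simp
  qed
qed

lemma Ck_on_scaleR:
  assumes S: "open S" and "Ck_on k r S" "Ck_on k F S"
  shows "Ck_on k (\<lambda>y. r y *\<^sub>R F y) S"
  using assms(2,3)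
proof (induction k arbitrary: r F)
  case 0
  then show ?case by (simp add: continuous_on_scaleR)
next
  case (Suc k)
  show ?case
  proof (rule Ck_on_SucI[OF S])
    show "((\<lambda>y. r y *\<^sub>R F y) has_derivative
        (\<lambda>u. r y *\<^sub>R dir_deriv F y u + dir_deriv r y u *\<^sub>R F y)) (at y)"
      if "y \<in> S" for y
      using Suc.prems that by (intro has_derivative_scaleR Ck_on_has_derivative)
    have "Ck_on k r S" "Ck_on k F S"
      using Suc.prems Ck_on_Suc_imp by blast+
    then show "Ck_on k (\<lambda>y. r y *\<^sub>R dir_deriv F y u + dir_deriv r y u *\<^sub>R F y) S" for u
      using Suc by (intro Ck_on_add[OF S] Suc.IH) simp_all
  qed
qed

lemma Ck_on_bounded_linear:
  assumes S: "open S" and T: "bounded_linear T" and "Ck_on k F S"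
  shows "Ck_on k (\<lambda>y. T (F y)) S"
  using assms(3)
proof (induction k arbitrary: F)
  case 0
  then show ?case using T by (simp add: bounded_linear.continuous_on)
next
  case (Suc k)
  show ?case
  proof (rule Ck_on_SucI[OF S])
    show "((\<lambda>y. T (F y)) has_derivative (\<lambda>u. T (dir_deriv F y u))) (at y)"
      if "y \<in> S" for y
      using Suc.prems that by (intro bounded_linear.has_derivative[OF T] Ck_on_has_derivative)
    show "Ck_on k (\<lambda>y. T (dir_deriv F y u)) S" for u
      using Suc by simp
  qed
qed

lemma Ck_on_sum:
  assumes "open S" "\<And>i. i \<in> I \<Longrightarrow> Ck_on k (F i) S"
  shows "Ck_on k (\<lambda>y. \<Sum>i\<in>I. F i y) S"
  using assms(2)
  by (induction I rule: infinite_finite_induct)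
     (simp_all add: Ck_on_const[OF assms(1)] Ck_on_add[OF assms(1)])

lemma smooth_on_differentiable: "smooth_on F S \<Longrightarrow> y \<in> S \<Longrightarrow> F differentiable (at y)"
  unfolding smooth_on_def by (metis Ck_on.simps(2))

lemma smooth_on_has_derivative:
  "smooth_on F S \<Longrightarrow> y \<in> S \<Longrightarrow> (F has_derivative dir_deriv F y) (at y)"
  by (simp add: has_dir_deriv smooth_on_differentiable)

lemma smooth_on_dir_deriv: "smooth_on F S \<Longrightarrow> smooth_on (\<lambda>y. dir_deriv F y u) S"
  unfolding smooth_on_def by (metis Ck_on.simps(2))

lemma smooth_on_continuous: "smooth_on F S \<Longrightarrow> continuous_on S F"
  unfolding smooth_on_def using Ck_on_continuous by blast

lemma smooth_on_cong:
  "open S \<Longrightarrow> (\<And>x. x \<in> S \<Longrightarrow> F x = G x) \<Longrightarrow> smooth_on F S \<longleftrightarrow> smooth_on G S"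
  unfolding smooth_on_def using Ck_on_cong by blast

lemma smooth_on_add:
  "open S \<Longrightarrow> smooth_on F S \<Longrightarrow> smooth_on G S \<Longrightarrow> smooth_on (\<lambda>y. F y + G y) S"
  unfolding smooth_on_def by (blast intro: Ck_on_add)

lemma smooth_on_scaleR:
  "open S \<Longrightarrow> smooth_on r S \<Longrightarrow> smooth_on F S \<Longrightarrow> smooth_on (\<lambda>y. r y *\<^sub>R F y) S"
  unfolding smooth_on_def by (blast intro: Ck_on_scaleR)

lemma smooth_on_const: "open S \<Longrightarrow> smooth_on (\<lambda>y. c) S"
  unfolding smooth_on_def by (blast intro: Ck_on_const)

lemma smooth_on_bounded_linear:
  "open S \<Longrightarrow> bounded_linear T \<Longrightarrow> smooth_on F S \<Longrightarrow> smooth_on (\<lambda>y. T (F y)) S"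
  unfolding smooth_on_def by (blast intro: Ck_on_bounded_linear)

lemma smooth_on_sum:
  "open S \<Longrightarrow> (\<And>i. i \<in> I \<Longrightarrow> smooth_on (F i) S) \<Longrightarrow> smooth_on (\<lambda>y. \<Sum>i\<in>I. F i y) S"
  unfolding smooth_on_def by (blast intro: Ck_on_sum)

lemma has_derivative_along_line:
  fixes y u :: "'a::real_normed_vector"
  assumes "F differentiable (at (y + s *\<^sub>R u))"
  shows "((\<lambda>s. F (y + s *\<^sub>R u)) has_derivative (\<lambda>h. h *\<^sub>R dir_deriv F (y + s *\<^sub>R u) u)) (at s)"
proof -
  have "((\<lambda>s. F (y + s *\<^sub>R u)) has_derivative (\<lambda>h. dir_deriv F (y + s *\<^sub>R u) (h *\<^sub>R u))) (at s)"
    by (rule has_derivative_compose[of "\<lambda>s. y + s *\<^sub>R u" "\<lambda>h. h *\<^sub>R u", OF _ has_dir_deriv[OF assms]])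
       (auto intro!: derivative_eq_intros)
  then show ?thesis using linear_dir_deriv[OF assms] by (simp add: linear_scale)
qed

lemma mvt_along_line:
  fixes F :: "'a::real_normed_vector \<Rightarrow> real"
  assumes "0 < s" "\<And>r. 0 \<le> r \<Longrightarrow> r \<le> s \<Longrightarrow> F differentiable (at (y + r *\<^sub>R u))"
  obtains r where "0 < r" "r < s" "F (y + s *\<^sub>R u) - F y = s * dir_deriv F (y + r *\<^sub>R u) u"
proof -
  have *: "((\<lambda>s. F (y + s *\<^sub>R u)) has_derivative (\<lambda>h. h *\<^sub>R dir_deriv F (y + r *\<^sub>R u) u)) (at r)"
    if "0 \<le> r" "r \<le> s" for r
    using assms that by (intro has_derivative_along_line) auto
  have "continuous_on {0..s} (\<lambda>s. F (y + s *\<^sub>R u))"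
    by (intro continuous_at_imp_continuous_on ballI has_derivative_continuous[OF *]) auto
  from mvt[OF \<open>0 < s\<close> this, where f' = "\<lambda>r h. h *\<^sub>R dir_deriv F (y + r *\<^sub>R u) u"] *
  obtain r where "0 < r" "r < s" "F (y + s *\<^sub>R u) - F y = s * dir_deriv F (y + r *\<^sub>R u) u"
    by (auto simp: less_imp_le)
  then show ?thesis by (rule that)
qed

text \<open>The second difference of \<open>F\<close> over the parallelogram spanned by \<open>s u\<close> and \<open>s v\<close> is, by the
  mean value theorem applied twice, \<open>s\<^sup>2\<close> times a mixed second derivative at a point of that
  parallelogram. Exchanging \<open>u\<close> and \<open>v\<close> does not change the second difference.\<close>

lemma second_difference_mvt:
  fixes F :: "'a::real_normed_vector \<Rightarrow> real"
  assumes "smooth_on F S" "0 < s"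
    and S: "\<And>a b. 0 \<le> a \<Longrightarrow> a \<le> s \<Longrightarrow> 0 \<le> b \<Longrightarrow> b \<le> s \<Longrightarrow> y + a *\<^sub>R u + b *\<^sub>R v \<in> S"
  obtains a b where "0 \<le> a" "a \<le> s" "0 \<le> b" "b \<le> s"
    "F (y + s *\<^sub>R u + s *\<^sub>R v) - F (y + s *\<^sub>R u) - F (y + s *\<^sub>R v) + F y
       = s * s * dir_deriv (\<lambda>y. dir_deriv F y u) (y + a *\<^sub>R u + b *\<^sub>R v) v"
proof -
  note d = smooth_on_differentiable[OF assms(1)]
  let ?K = "\<lambda>z. F (z + s *\<^sub>R v) - F z"
  have K: "(?K has_derivative (\<lambda>h. dir_deriv F (z + s *\<^sub>R v) h - dir_deriv F z h)) (at z)"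
    if "z \<in> S" "z + s *\<^sub>R v \<in> S" for z
  proof -
    have "((\<lambda>z. F (z + s *\<^sub>R v)) has_derivative dir_deriv F (z + s *\<^sub>R v)) (at z)"
      by (rule has_derivative_compose[of "\<lambda>z. z + s *\<^sub>R v" "\<lambda>h. h", OF _ has_dir_deriv[OF d[OF that(2)]]])
         (auto intro!: derivative_eq_intros)
    then show ?thesis using has_dir_deriv[OF d[OF that(1)]] by (rule has_derivative_diff)
  qed
  have inS: "y + r *\<^sub>R u \<in> S" "y + r *\<^sub>R u + s *\<^sub>R v \<in> S" if "0 \<le> r" "r \<le> s" for r
    using S[of r 0] S[of r s] that \<open>0 < s\<close> by auto
  have Kd: "?K differentiable (at (y + r *\<^sub>R u))" if "0 \<le> r" "r \<le> s" for r
    using K[OF inS[OF that]] by (auto simp: differentiable_def)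
  obtain a where a: "0 < a" "a < s" "?K (y + s *\<^sub>R u) - ?K y = s * dir_deriv ?K (y + a *\<^sub>R u) u"
    using mvt_along_line[OF \<open>0 < s\<close> Kd] by blast
  let ?L = "\<lambda>y. dir_deriv F y u"
  have Ld: "?L differentiable (at (y + a *\<^sub>R u + r *\<^sub>R v))" if "0 \<le> r" "r \<le> s" for r
    using smooth_on_differentiable[OF smooth_on_dir_deriv[OF assms(1)]] S[of a r] a that by auto
  obtain b where b: "0 < b" "b < s"
    "?L (y + a *\<^sub>R u + s *\<^sub>R v) - ?L (y + a *\<^sub>R u) = s * dir_deriv ?L (y + a *\<^sub>R u + b *\<^sub>R v) v"
    using mvt_along_line[OF \<open>0 < s\<close> Ld] by blast
  have "dir_deriv ?K (y + a *\<^sub>R u) u = ?L (y + a *\<^sub>R u + s *\<^sub>R v) - ?L (y + a *\<^sub>R u)"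
    using dir_deriv_eq[OF K[OF inS]] a by simp
  with a b show ?thesis
    by (intro that[of a b]) (simp_all add: algebra_simps)
qed

text \<open>Two mixed second derivatives at nearby points agree by \<open>second_difference_mvt\<close>; continuity
  transfers this to the point \<open>y\<close>.\<close>

lemma dir_deriv_commute_real:
  fixes F :: "'a::real_normed_vector \<Rightarrow> real"
  assumes F: "smooth_on F S" and S: "open S" "y \<in> S"
  shows "dir_deriv (\<lambda>y. dir_deriv F y u) y v = dir_deriv (\<lambda>y. dir_deriv F y v) y u"
proof -
  let ?A = "\<lambda>u v z. dir_deriv (\<lambda>y. dir_deriv F y u) z v"
  obtain e where e: "0 < e" "ball y e \<subseteq> S" using S openE by blast
  have cont: "isCont (?A u v) y" for u v
    using smooth_on_continuous[OF smooth_on_dir_deriv[OF smooth_on_dir_deriv[OF F]]] S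
    by (simp add: continuous_on_eq_continuous_at)
  have "\<bar>?A u v y - ?A v u y\<bar> \<le> 0 + 2 * r" if "0 < r" for r
  proof -
    obtain d1 where d1: "0 < d1" "\<And>z. dist z y < d1 \<Longrightarrow> \<bar>?A u v z - ?A u v y\<bar> < r"
      using cont[of u v] \<open>0 < r\<close> unfolding continuous_at_eps_delta dist_real_def by blast
    obtain d2 where d2: "0 < d2" "\<And>z. dist z y < d2 \<Longrightarrow> \<bar>?A v u z - ?A v u y\<bar> < r"
      using cont[of v u] \<open>0 < r\<close> unfolding continuous_at_eps_delta dist_real_def by blast
    define d where "d = min e (min d1 d2)"
    have d: "0 < d" using e d1 d2 by (simp add: d_def)
    \<comment> \<open>a side length for which the parallelogram stays within distance \<open>d\<close> of \<open>y\<close>; the summand 1 covers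
      the case that both \<open>u\<close> and \<open>v\<close> are zero\<close>
    define s where "s = d / (norm u + norm v + 1)"
    have s: "0 < s" using d by (simp add: s_def add_nonneg_pos)
    have small: "dist (y + a *\<^sub>R u' + b *\<^sub>R v') y < d"
      if "0 \<le> a" "a \<le> s" "0 \<le> b" "b \<le> s" "norm u' + norm v' = norm u + norm v" for a b u' v'
    proof -
      have "dist (y + a *\<^sub>R u' + b *\<^sub>R v') y \<le> a * norm u' + b * norm v'"
        using norm_triangle_ineq[of "a *\<^sub>R u'" "b *\<^sub>R v'"] that by (simp add: dist_norm add.assoc)
      also have "\<dots> \<le> s * norm u' + s * norm v'"
        using that by (intro add_mono mult_right_mono) auto
      also have "\<dots> = s * (norm u + norm v)" using that(5) by (metis distrib_left)
      also have "\<dots> < s * (norm u + norm v + 1)" using s by simp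
      also have "\<dots> = d"
        using add_nonneg_pos[of "norm u + norm v" 1] unfolding s_def by simp
      finally show ?thesis .
    qed
    have inS: "y + a *\<^sub>R u' + b *\<^sub>R v' \<in> S"
      if "0 \<le> a" "a \<le> s" "0 \<le> b" "b \<le> s" "norm u' + norm v' = norm u + norm v" for a b u' v'
    proof -
      have "dist y (y + a *\<^sub>R u' + b *\<^sub>R v') < e"
        using small[OF that] unfolding d_def by (simp add: dist_commute)
      then show ?thesis using e(2) by auto
    qed
    obtain a b where ab: "0 \<le> a" "a \<le> s" "0 \<le> b" "b \<le> s"
      "F (y + s *\<^sub>R u + s *\<^sub>R v) - F (y + s *\<^sub>R u) - F (y + s *\<^sub>R v) + F y
         = s * s * ?A u v (y + a *\<^sub>R u + b *\<^sub>R v)"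
      using second_difference_mvt[OF F s, of y u v] inS by blast
    obtain a' b' where ab': "0 \<le> a'" "a' \<le> s" "0 \<le> b'" "b' \<le> s"
      "F (y + s *\<^sub>R v + s *\<^sub>R u) - F (y + s *\<^sub>R v) - F (y + s *\<^sub>R u) + F y
         = s * s * ?A v u (y + a' *\<^sub>R v + b' *\<^sub>R u)"
      using second_difference_mvt[OF F s, of y v u] inS by (metis add.commute)
    have swap: "y + s *\<^sub>R v + s *\<^sub>R u = y + s *\<^sub>R u + s *\<^sub>R v" by (simp add: algebra_simps)
    have "s * s * ?A u v (y + a *\<^sub>R u + b *\<^sub>R v) = s * s * ?A v u (y + a' *\<^sub>R v + b' *\<^sub>R u)"
      using ab(5) ab'(5) unfolding swap by linarith
    then have "?A u v (y + a *\<^sub>R u + b *\<^sub>R v) = ?A v u (y + a' *\<^sub>R v + b' *\<^sub>R u)"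
      using s by simp
    moreover have "dist (y + a *\<^sub>R u + b *\<^sub>R v) y < d1" "dist (y + a' *\<^sub>R v + b' *\<^sub>R u) y < d2"
      using small[OF ab(1-4), of u v] small[OF ab'(1-4), of v u] unfolding d_def by auto
    ultimately show ?thesis
      using d1(2)[of "y + a *\<^sub>R u + b *\<^sub>R v"] d2(2)[of "y + a' *\<^sub>R v + b' *\<^sub>R u"] by linarith
  qed
  then have "\<bar>?A u v y - ?A v u y\<bar> \<le> 0 + r" if "0 < r" for r
    using that by (metis field_sum_of_halves half_gt_zero mult_2)
  then have "\<bar>?A u v y - ?A v u y\<bar> \<le> 0" by (rule field_le_epsilon)
  then show ?thesis by simp
qed

lemma dir_deriv_commute:
  fixes F :: "'a::real_normed_vector \<Rightarrow> 'b::euclidean_space"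
  assumes F: "smooth_on F S" and S: "open S" "y \<in> S"
  shows "dir_deriv (\<lambda>y. dir_deriv F y u) y v = dir_deriv (\<lambda>y. dir_deriv F y v) y u"
proof (rule euclidean_eqI)
  fix b :: 'b assume "b \<in> Basis"
  have comp: "dir_deriv (\<lambda>y. H y \<bullet> b) z w = dir_deriv H z w \<bullet> b"
    if "smooth_on H S" "z \<in> S" for H :: "'a \<Rightarrow> 'b" and z w
    by (rule dir_deriv_eq)
       (intro has_derivative_inner_left smooth_on_has_derivative[OF that])
  have second: "dir_deriv (\<lambda>y. dir_deriv F y u) y v \<bullet> b
      = dir_deriv (\<lambda>y. dir_deriv (\<lambda>y. F y \<bullet> b) y u) y v" for u v
  proof -
    have "dir_deriv (\<lambda>y. dir_deriv (\<lambda>y. F y \<bullet> b) y u) y v = dir_deriv (\<lambda>y. dir_deriv F y u \<bullet> b) y v"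
      by (subst dir_deriv_cong[OF S]) (simp_all add: comp[OF F])
    also have "\<dots> = dir_deriv (\<lambda>y. dir_deriv F y u) y v \<bullet> b"
      by (rule comp[OF smooth_on_dir_deriv[OF F] S(2)])
    finally show ?thesis by simp
  qed
  have "smooth_on (\<lambda>y. F y \<bullet> b) S"
    by (intro smooth_on_bounded_linear[OF S(1) bounded_linear_inner_left] F)
  from dir_deriv_commute_real[OF this S, of u v] show
    "dir_deriv (\<lambda>y. dir_deriv F y u) y v \<bullet> b = dir_deriv (\<lambda>y. dir_deriv F y v) y u \<bullet> b"
    by (simp add: second)
qed

section \<open>Smooth families of linear maps\<close>

lemma linear_basis_expansion:
  fixes T :: "'a::euclidean_space \<Rightarrow> 'b::real_vector"
  assumes "linear T"
  shows "T w = (\<Sum>b\<in>Basis. (w \<bullet> b) *\<^sub>R T b)"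
proof -
  have "T w = T (\<Sum>b\<in>Basis. (w \<bullet> b) *\<^sub>R b)" by (simp add: euclidean_representation)
  also have "\<dots> = (\<Sum>b\<in>Basis. (w \<bullet> b) *\<^sub>R T b)"
    using assms by (simp add: linear_sum linear_scale)
  finally show ?thesis .
qed

text \<open>The product rule for a linear map depending on a point, applied to a vector field: expand the
  vector in the standard basis, so that only products with real functions occur.\<close>

lemma has_derivative_linear_family:
  fixes M :: "'a::real_normed_vector \<Rightarrow> 'b::euclidean_space \<Rightarrow> 'c::real_normed_vector"
  assumes S: "open S" "y \<in> S" and lin: "\<And>z. z \<in> S \<Longrightarrow> linear (M z)"
    and M: "\<And>w. (\<lambda>z. M z w) differentiable (at y)" and N: "(N has_derivative N') (at y)"
  shows "((\<lambda>z. M z (N z)) has_derivative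
           (\<lambda>k. dir_deriv (\<lambda>z. M z (N y)) y k + M y (N' k))) (at y)"
proof -
  have sums: "((\<lambda>z. M z (V z)) has_derivative
      (\<lambda>k. \<Sum>b\<in>Basis. (V y \<bullet> b) *\<^sub>R dir_deriv (\<lambda>z. M z b) y k + (V' k \<bullet> b) *\<^sub>R M y b)) (at y)"
    if "(V has_derivative V') (at y)" for V V'
  proof (rule has_derivative_transform_within_open[OF _ S])
    show "((\<lambda>z. \<Sum>b\<in>Basis. (V z \<bullet> b) *\<^sub>R M z b) has_derivative
      (\<lambda>k. \<Sum>b\<in>Basis. (V y \<bullet> b) *\<^sub>R dir_deriv (\<lambda>z. M z b) y k + (V' k \<bullet> b) *\<^sub>R M y b)) (at y)"
      by (intro has_derivative_sum has_derivative_scaleR has_derivative_inner_left that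
           has_dir_deriv M)
    show "(\<Sum>b\<in>Basis. (V z \<bullet> b) *\<^sub>R M z b) = M z (V z)" if "z \<in> S" for z
      using linear_basis_expansion[OF lin[OF that]] by metis
  qed
  have "dir_deriv (\<lambda>z. M z (N y)) y k = (\<Sum>b\<in>Basis. (N y \<bullet> b) *\<^sub>R dir_deriv (\<lambda>z. M z b) y k)" for k
    using dir_deriv_eq[OF sums[OF has_derivative_const], of "N y" k] by simp
  moreover have "M y (N' k) = (\<Sum>b\<in>Basis. (N' k \<bullet> b) *\<^sub>R M y b)" for k
    by (rule linear_basis_expansion[OF lin[OF S(2)]])
  ultimately show ?thesis
    using sums[OF N] by (simp add: sum.distrib)
qed

lemma dir_deriv_linear_family:
  fixes M :: "'a::real_normed_vector \<Rightarrow> 'b::euclidean_space \<Rightarrow> 'c::real_normed_vector"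
  assumes "open S" "y \<in> S" "\<And>z. z \<in> S \<Longrightarrow> linear (M z)"
    and "\<And>w. (\<lambda>z. M z w) differentiable (at y)" and N: "N differentiable (at y)"
  shows "dir_deriv (\<lambda>z. M z (N z)) y k = dir_deriv (\<lambda>z. M z (N y)) y k + M y (dir_deriv N y k)"
  by (rule dir_deriv_eq[OF has_derivative_linear_family[OF assms(1-4) has_dir_deriv[OF N]]])

lemma linear_dir_deriv_family:
  assumes S: "open S" "y \<in> S" and lin: "\<And>z. z \<in> S \<Longrightarrow> linear (M z)"
    and M: "\<And>w. (\<lambda>z. M z w) differentiable (at y)"
  shows "linear (\<lambda>w. dir_deriv (\<lambda>z. M z w) y u)"
proof (rule linearI)
  fix v w c
  have "((\<lambda>z. M z v + M z w) has_derivative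
      (\<lambda>u. dir_deriv (\<lambda>z. M z v) y u + dir_deriv (\<lambda>z. M z w) y u)) (at y)"
    by (intro has_derivative_add has_dir_deriv M)
  then have "((\<lambda>z. M z (v + w)) has_derivative
      (\<lambda>u. dir_deriv (\<lambda>z. M z v) y u + dir_deriv (\<lambda>z. M z w) y u)) (at y)"
    by (rule has_derivative_transform_within_open[OF _ S]) (simp add: lin linear_add)
  then show "dir_deriv (\<lambda>z. M z (v + w)) y u = dir_deriv (\<lambda>z. M z v) y u + dir_deriv (\<lambda>z. M z w) y u"
    by (rule dir_deriv_eq)
  have "((\<lambda>z. c *\<^sub>R M z v) has_derivative (\<lambda>u. c *\<^sub>R dir_deriv (\<lambda>z. M z v) y u)) (at y)"
    by (intro has_derivative_scaleR_right has_dir_deriv M)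
  then have "((\<lambda>z. M z (c *\<^sub>R v)) has_derivative (\<lambda>u. c *\<^sub>R dir_deriv (\<lambda>z. M z v) y u)) (at y)"
    by (rule has_derivative_transform_within_open[OF _ S]) (simp add: lin linear_scale)
  then show "dir_deriv (\<lambda>z. M z (c *\<^sub>R v)) y u = c *\<^sub>R dir_deriv (\<lambda>z. M z v) y u"
    by (rule dir_deriv_eq)
qed

lemma Ck_on_linear_family:
  fixes M :: "'a::real_normed_vector \<Rightarrow> 'b::euclidean_space \<Rightarrow> 'c::real_normed_vector"
  assumes S: "open S" and lin: "\<And>z. z \<in> S \<Longrightarrow> linear (M z)"
    and M: "\<And>w. Ck_on k (\<lambda>z. M z w) S" and N: "Ck_on k N S"
  shows "Ck_on k (\<lambda>z. M z (N z)) S"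
proof -
  have "Ck_on k (\<lambda>z. \<Sum>b\<in>Basis. (N z \<bullet> b) *\<^sub>R M z b) S"
    by (intro Ck_on_sum Ck_on_scaleR S Ck_on_bounded_linear[OF S bounded_linear_inner_left] M N)
  then show ?thesis
    by (subst Ck_on_cong[OF S linear_basis_expansion[OF lin]])
qed

lemma smooth_on_linear_family:
  fixes M :: "'a::real_normed_vector \<Rightarrow> 'b::euclidean_space \<Rightarrow> 'c::real_normed_vector"
  assumes "open S" "\<And>z. z \<in> S \<Longrightarrow> linear (M z)" "\<And>w. smooth_on (\<lambda>z. M z w) S" "smooth_on N S"
  shows "smooth_on (\<lambda>z. M z (N z)) S"
  using assms unfolding smooth_on_def by (blast intro: Ck_on_linear_family)

text \<open>The map \<open>(z, w) \<mapsto> (z, L z w)\<close> has the inverse \<open>(z, m) \<mapsto> (z, inv (L z) m)\<close> and an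
  invertible derivative, so the inverse function theorem gives differentiability of the inverse
  jointly in the point and the vector.\<close>

lemma inv_linear_family_differentiable:
  fixes L :: "'a::euclidean_space \<Rightarrow> 'b::euclidean_space \<Rightarrow> 'b"
  assumes S: "open S" and lin: "\<And>z. z \<in> S \<Longrightarrow> linear (L z)" and inj: "\<And>z. z \<in> S \<Longrightarrow> inj (L z)"
    and L: "\<And>w. smooth_on (\<lambda>z. L z w) S" and y: "y \<in> S"
  shows "(\<lambda>q. inv (L (fst q)) (snd q)) differentiable (at (y, m))"
proof -
  have surj: "surj (L z)" if "z \<in> S" for z
    using linear_injective_imp_surjective lin[OF that] inj[OF that] by blast
  define w where "w = inv (L y) m"
  have Lw: "L y w = m" unfolding w_def by (rule surj_f_inv_f[OF surj[OF y]])
  let ?f = "\<lambda>q. (fst q, L (fst q) (snd q))" and ?g = "\<lambda>q. (fst q, inv (L (fst q)) (snd q))"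
  let ?f' = "\<lambda>q. (fst q, dir_deriv (\<lambda>z. L z w) y (fst q) + L y (snd q))"
  let ?g' = "\<lambda>q. (fst q, inv (L y) (snd q - dir_deriv (\<lambda>z. L z w) y (fst q)))"
  have f: "(?f has_derivative (\<lambda>q. (fst q, dir_deriv (\<lambda>z. L z v) z (fst q) + L z (snd q)))) (at (z, v))"
    if "z \<in> S" for z v
  proof -
    have fst: "(fst has_derivative fst) (at q)" and snd: "(snd has_derivative snd) (at q)"
      for q :: "'a \<times> 'b"
      using has_derivative_fst[OF has_derivative_ident] has_derivative_snd[OF has_derivative_ident]
      by blast+
    have d: "((\<lambda>q::'a \<times> 'b. L (fst q) b) has_derivative (\<lambda>q. dir_deriv (\<lambda>z. L z b) z (fst q))) (at (z, v))" for b
    proof (rule has_derivative_compose[OF fst])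
      show "((\<lambda>z. L z b) has_derivative dir_deriv (\<lambda>z. L z b) z) (at (fst (z, v)))"
        using smooth_on_has_derivative[OF L that] by simp
    qed
    have "((\<lambda>q::'a \<times> 'b. L (fst q) (snd q)) has_derivative
        (\<lambda>q. dir_deriv (\<lambda>q. L (fst q) (snd (z, v))) (z, v) q + L (fst (z, v)) (snd q))) (at (z, v))"
    proof (rule has_derivative_linear_family[OF _ _ _ _ snd])
      show "open (S \<times> (UNIV::'b set))" "(z, v) \<in> S \<times> UNIV"
        using S that by (auto simp: open_Times)
      show "linear (L (fst q))" if "q \<in> S \<times> UNIV" for q :: "'a \<times> 'b"
        using lin that by (simp add: mem_Times_iff)
      show "(\<lambda>q::'a \<times> 'b. L (fst q) b) differentiable (at (z, v))" for b
        unfolding differentiable_def using d by blast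
    qed
    then have "((\<lambda>q::'a \<times> 'b. L (fst q) (snd q)) has_derivative
        (\<lambda>q. dir_deriv (\<lambda>z. L z v) z (fst q) + L z (snd q))) (at (z, v))"
      by (simp add: dir_deriv_eq[OF d])
    with fst show ?thesis by (rule has_derivative_Pair)
  qed
  have "(?g has_derivative ?g') (at (?f (y, w)))"
  proof (rule has_derivative_inverse_strong[where f = ?f and x = "(y, w)" and S = "S \<times> UNIV"])
    show "open (S \<times> (UNIV::'b set))" "(y, w) \<in> S \<times> UNIV"
      using S y by (auto simp: open_Times)
    show "continuous_on (S \<times> UNIV) ?f"
    proof (intro continuous_at_imp_continuous_on ballI)
      fix q assume "q \<in> S \<times> (UNIV::'b set)"
      then show "isCont ?f q"
        using has_derivative_continuous[OF f[of "fst q" "snd q"]] by (simp add: mem_Times_iff)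
    qed
    show "?g (?f q) = q" if "q \<in> S \<times> UNIV" for q
      using that by (auto simp: inv_f_f[OF inj])
    show "(?f has_derivative ?f') (at (y, w))" by (rule f[OF y])
    show "?f' \<circ> ?g' = id"
      by (rule ext) (simp add: surj_f_inv_f[OF surj[OF y]])
  qed
  then have "(?g has_derivative ?g') (at (y, m))" by (simp add: Lw)
  from has_derivative_snd[OF this] have "((\<lambda>q. inv (L (fst q)) (snd q)) has_derivative
      (\<lambda>q. inv (L y) (snd q - dir_deriv (\<lambda>z. L z w) y (fst q)))) (at (y, m))" by simp
  then show ?thesis by (auto simp: differentiable_def)
qed

text \<open>Differentiating \<open>L N = \<theta>\<close> shows that the derivative of the solution \<open>N\<close> solves a linear
  equation with the same \<open>L\<close>, whose right-hand side involves \<open>N\<close> itself but no derivative of it.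
  This starts an induction on the order of differentiability.\<close>

lemma Ck_on_inv_linear_family:
  fixes L :: "'a::euclidean_space \<Rightarrow> 'b::euclidean_space \<Rightarrow> 'b"
  assumes S: "open S" and lin: "\<And>z. z \<in> S \<Longrightarrow> linear (L z)" and inj: "\<And>z. z \<in> S \<Longrightarrow> inj (L z)"
    and L: "\<And>w. smooth_on (\<lambda>z. L z w) S" and "Ck_on k \<theta> S"
  shows "Ck_on k (\<lambda>z. inv (L z) (\<theta> z)) S"
  using assms(5)
proof (induction k arbitrary: \<theta>)
  case 0
  have joint: "(\<lambda>q. inv (L (fst q)) (snd q)) differentiable (at (y, m))" if "y \<in> S" for y m
    using S lin inj L that by (rule inv_linear_family_differentiable)
  have "continuous_on S (\<lambda>z. inv (L (fst (z, \<theta> z))) (snd (z, \<theta> z)))"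
  proof (rule continuous_on_compose2[where t = "S \<times> UNIV"])
    show "continuous_on (S \<times> UNIV) (\<lambda>q. inv (L (fst q)) (snd q))"
    proof (intro continuous_at_imp_continuous_on ballI)
      fix q assume "q \<in> S \<times> (UNIV :: 'b set)"
      then show "isCont (\<lambda>q. inv (L (fst q)) (snd q)) q"
        using differentiable_imp_continuous_within[OF joint[of "fst q" "snd q"]]
        by (simp add: mem_Times_iff)
    qed
    show "continuous_on S (\<lambda>z. (z, \<theta> z))"
      using 0 by (auto intro: continuous_intros)
  qed auto
  then show ?case by simp
next
  case (Suc k)
  have joint: "(\<lambda>q. inv (L (fst q)) (snd q)) differentiable (at (y, m))" if "y \<in> S" for y m
    using S lin inj L that by (rule inv_linear_family_differentiable)
  let ?N = "\<lambda>z. inv (L z) (\<theta> z)"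
  have N: "?N differentiable (at y)" if "y \<in> S" for y
  proof -
    have "(\<lambda>z. (z, \<theta> z)) differentiable (at y)"
      using has_derivative_Pair[OF has_derivative_ident Ck_on_has_derivative[OF Suc.prems that]]
      by (auto simp: differentiable_def)
    from differentiable_chain_at[OF this, of "\<lambda>q. inv (L (fst q)) (snd q)"] joint[OF that]
    show ?thesis by (simp add: o_def)
  qed
  have LN: "L z (?N z) = \<theta> z" if "z \<in> S" for z
    using surj_f_inv_f linear_injective_imp_surjective lin[OF that] inj[OF that] by metis
  let ?M = "\<lambda>u z w. dir_deriv (\<lambda>z. L z w) z u"
  have DN: "dir_deriv ?N y u = inv (L y) (dir_deriv \<theta> y u - ?M u y (?N y))" if "y \<in> S" for y u
  proof -
    have "dir_deriv \<theta> y u = dir_deriv (\<lambda>z. L z (?N z)) y u"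
      using dir_deriv_cong[OF S that, of \<theta> "\<lambda>z. L z (?N z)"] LN by simp
    also have "\<dots> = ?M u y (?N y) + L y (dir_deriv ?N y u)"
      by (rule dir_deriv_linear_family[OF S that _ _ N[OF that]])
         (simp_all add: lin smooth_on_differentiable[OF L that])
    finally have "L y (dir_deriv ?N y u) = dir_deriv \<theta> y u - ?M u y (?N y)" by simp
    then show ?thesis using inv_f_f[OF inj[OF that]] by metis
  qed
  have lin_M: "linear (?M u y)" if "y \<in> S" for u y
    using linear_dir_deriv_family[OF S that lin smooth_on_differentiable[OF L that]] by blast
  have M: "Ck_on k (\<lambda>z. ?M u z w) S" for u w
    using smooth_on_dir_deriv[OF L] by (simp add: smooth_on_def)
  have "Ck_on k ?N S"
    using Suc.IH Ck_on_Suc_imp[OF Suc.prems] by blast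
  then have "Ck_on k (\<lambda>z. ?M u z (?N z)) S" for u
    using Ck_on_linear_family[OF S lin_M M] by blast
  then have "Ck_on k (\<lambda>z. - ?M u z (?N z)) S" for u
    by (rule Ck_on_bounded_linear[OF S bounded_linear_minus[OF bounded_linear_ident]])
  moreover have "Ck_on k (\<lambda>z. dir_deriv \<theta> z u) S" for u
    using Suc.prems by simp
  ultimately have "Ck_on k (\<lambda>z. dir_deriv \<theta> z u + - ?M u z (?N z)) S" for u
    by (intro Ck_on_add S)
  then have "Ck_on k (\<lambda>z. inv (L z) (dir_deriv \<theta> z u - ?M u z (?N z))) S" for u
    by (intro Suc.IH) simp
  then have "Ck_on k (\<lambda>z. dir_deriv ?N z u) S" for u
    by (subst Ck_on_cong[OF S DN])
  then show ?case using N by simp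
qed

lemma smooth_on_inv_linear_family:
  fixes L :: "'a::euclidean_space \<Rightarrow> 'b::euclidean_space \<Rightarrow> 'b"
  assumes "open S" "\<And>z. z \<in> S \<Longrightarrow> linear (L z)" "\<And>z. z \<in> S \<Longrightarrow> inj (L z)"
    and "\<And>w. smooth_on (\<lambda>z. L z w) S" "smooth_on \<theta> S"
  shows "smooth_on (\<lambda>z. inv (L z) (\<theta> z)) S"
  using Ck_on_inv_linear_family[OF assms(1-4)] assms(5) by (simp add: smooth_on_def)

section \<open>Metrics and concircular functions in a chart\<close>

text \<open>The Koszul formula determines the Christoffel vector as soon as the form at \<open>y\<close> separates points;
  this is the way to verify a guessed formula.\<close>

lemma christoffel_eqI:
  assumes "\<And>w w'. (\<And>z. G y w z = G y w' z) \<Longrightarrow> w = w'"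
    and "\<And>z. 2 * G y w z = dir_deriv (\<lambda>y'. G y' v z) y u + dir_deriv (\<lambda>y'. G y' u z) y v
                 - dir_deriv (\<lambda>y'. G y' u v) y z"
  shows "christoffel G y u v = w"
  unfolding christoffel_def
proof (rule the_equality)
  fix w' assume "\<forall>z. 2 * G y w' z = dir_deriv (\<lambda>y'. G y' v z) y u
    + dir_deriv (\<lambda>y'. G y' u z) y v - dir_deriv (\<lambda>y'. G y' u v) y z"
  then show "w' = w" using assms(2) by (intro assms(1)) (metis mult_cancel_left zero_neq_numeral)
qed (use assms(2) in blast)

text \<open>The coordinate representation of a metric on the image of a chart.\<close>

locale coordinate_metric =
  fixes S :: "'e::euclidean_space set" and G :: "'e \<Rightarrow> 'e \<Rightarrow> 'e \<Rightarrow> real"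
  assumes open_domain: "open S"
    and bilinear: "y \<in> S \<Longrightarrow> bilinear (G y)"
    and symmetric: "y \<in> S \<Longrightarrow> G y u v = G y v u"
    and nondegenerate: "y \<in> S \<Longrightarrow> (\<And>v. G y u v = 0) \<Longrightarrow> u = 0"
    and smooth: "smooth_on (\<lambda>y. G y u v) S"
begin

lemma linear_left: "y \<in> S \<Longrightarrow> linear (\<lambda>u. G y u v)"
  and linear_right: "y \<in> S \<Longrightarrow> linear (G y u)"
  using bilinear unfolding bilinear_def by blast+

lemma metric_eqI:
  assumes y: "y \<in> S" and eq: "\<And>z. G y w z = G y w' z"
  shows "w = w'"
proof -
  have "G y (w - w') z = 0" for z
    using eq linear_diff[OF linear_left[OF y]] by simp
  then show ?thesis using nondegenerate[OF y] by fastforce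
qed

text \<open>The endomorphism that turns the metric into the standard inner product, see \<open>gram_inner\<close>. It puts
  statements about dual vectors into the form of a linear system.\<close>

definition gram :: "'e \<Rightarrow> 'e \<Rightarrow> 'e" where
  "gram y w = (\<Sum>b\<in>Basis. G y w b *\<^sub>R b)"

text \<open>The musical isomorphism: the vector that represents a linear form with respect to the metric.\<close>

definition sharp :: "'e \<Rightarrow> ('e \<Rightarrow> real) \<Rightarrow> 'e" where
  "sharp y \<theta> = inv (gram y) (\<Sum>b\<in>Basis. \<theta> b *\<^sub>R b)"

lemma sum_basis_inner: "(\<Sum>b\<in>Basis. \<theta> b *\<^sub>R b) \<bullet> z = \<theta> z" if "linear \<theta>" for \<theta> :: "'e \<Rightarrow> real"
proof -
  have "(\<Sum>b\<in>Basis. \<theta> b *\<^sub>R b) \<bullet> z = (\<Sum>b\<in>Basis. (z \<bullet> b) *\<^sub>R \<theta> b)"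
    unfolding inner_sum_left inner_scaleR_left
    by (rule sum.cong) (simp_all add: inner_commute)
  then show ?thesis using linear_basis_expansion[OF that, of z] by simp
qed

lemma gram_inner: "y \<in> S \<Longrightarrow> gram y w \<bullet> z = G y w z"
  unfolding gram_def by (rule sum_basis_inner[OF linear_right])

lemma linear_gram: "y \<in> S \<Longrightarrow> linear (gram y)"
  unfolding gram_def
  by (intro linear_compose_sum ballI linear_compose_scale_right linear_left)
     (auto intro!: linearI simp: linear_add[OF linear_left] linear_scale[OF linear_left] scaleR_add_left)

lemma inj_gram: "y \<in> S \<Longrightarrow> inj (gram y)"
  by (rule injI) (metis metric_eqI gram_inner)

lemma smooth_gram: "smooth_on (\<lambda>y. gram y w) S"
  unfolding gram_def
  by (intro smooth_on_sum smooth_on_scaleR smooth smooth_on_const open_domain)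

lemma metric_sharp:
  assumes "y \<in> S" "linear \<theta>"
  shows "G y (sharp y \<theta>) z = \<theta> z"
proof -
  have "surj (gram y)"
    using linear_injective_imp_surjective linear_gram inj_gram assms(1) by blast
  then have "gram y (sharp y \<theta>) = (\<Sum>b\<in>Basis. \<theta> b *\<^sub>R b)"
    unfolding sharp_def by (rule surj_f_inv_f)
  then have "G y (sharp y \<theta>) z = (\<Sum>b\<in>Basis. \<theta> b *\<^sub>R b) \<bullet> z"
    using gram_inner[OF assms(1)] by metis
  then show ?thesis by (simp only: sum_basis_inner[OF assms(2)])
qed

lemma smooth_sharp:
  assumes "\<And>b. smooth_on (\<lambda>y. \<theta> y b) S"
  shows "smooth_on (\<lambda>y. sharp y (\<theta> y)) S"
proof -
  have "smooth_on (\<lambda>y. \<Sum>b\<in>Basis. \<theta> y b *\<^sub>R b) S"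
    by (rule smooth_on_sum[OF open_domain])
       (rule smooth_on_scaleR[OF open_domain assms smooth_on_const[OF open_domain]])
  from smooth_on_inv_linear_family[OF open_domain linear_gram inj_gram smooth_gram this]
  show ?thesis unfolding sharp_def by blast
qed

abbreviation \<Gamma> :: "'e \<Rightarrow> 'e \<Rightarrow> 'e \<Rightarrow> 'e" where
  "\<Gamma> \<equiv> christoffel G"

definition koszul :: "'e \<Rightarrow> 'e \<Rightarrow> 'e \<Rightarrow> 'e \<Rightarrow> real" where
  "koszul y u v z = (1/2) * (dir_deriv (\<lambda>y'. G y' v z) y u + dir_deriv (\<lambda>y'. G y' u z) y v
     - dir_deriv (\<lambda>y'. G y' u v) y z)"

lemma linear_metric_deriv:
  assumes y: "y \<in> S"
  shows "linear (\<lambda>v. dir_deriv (\<lambda>y. G y v z) y u)" "linear (\<lambda>z. dir_deriv (\<lambda>y. G y v z) y u)"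
    "linear (dir_deriv (\<lambda>y. G y v z) y)"
proof -
  note d = smooth_on_differentiable[OF smooth y]
  show "linear (dir_deriv (\<lambda>y. G y v z) y)" by (rule linear_dir_deriv[OF d])
  show "linear (\<lambda>v. dir_deriv (\<lambda>y. G y v z) y u)"
    using linear_dir_deriv_family[where M = "\<lambda>y v. G y v z", OF open_domain y linear_left d] by blast
  show "linear (\<lambda>z. dir_deriv (\<lambda>y. G y v z) y u)"
    using linear_dir_deriv_family[where M = "\<lambda>y. G y v", OF open_domain y linear_right d] by blast
qed

lemma linear_koszul: "y \<in> S \<Longrightarrow> linear (koszul y u v)"
proof -
  assume "y \<in> S"
  note lin = linear_metric_deriv[OF this]
  show ?thesis
    by (rule linearI)
       (simp_all add: koszul_def linear_add[OF lin(2)] linear_scale[OF lin(2)]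
         linear_add[OF lin(3)] linear_scale[OF lin(3)] algebra_simps)
qed

lemma christoffel_sharp: "y \<in> S \<Longrightarrow> \<Gamma> y u v = sharp y (koszul y u v)"
  by (rule christoffel_eqI) (auto intro: metric_eqI simp: metric_sharp linear_koszul, simp add: koszul_def)

lemma metric_christoffel: "y \<in> S \<Longrightarrow> G y (\<Gamma> y u v) z = koszul y u v z"
  by (simp add: christoffel_sharp metric_sharp linear_koszul)

lemma christoffel_commute: "y \<in> S \<Longrightarrow> \<Gamma> y u v = \<Gamma> y v u"
proof -
  assume y: "y \<in> S"
  have "dir_deriv (\<lambda>y. G y u v) y = dir_deriv (\<lambda>y. G y v u) y"
    by (rule dir_deriv_cong[OF open_domain y symmetric])
  then show ?thesis
    by (intro metric_eqI[OF y]) (simp add: metric_christoffel y koszul_def)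
qed

lemma linear_christoffel: "y \<in> S \<Longrightarrow> linear (\<Gamma> y u)"
proof (rule linearI)
  assume y: "y \<in> S"
  note lin = linear_metric_deriv[OF y] linear_left[OF y]
  show "\<Gamma> y u (v + w) = \<Gamma> y u v + \<Gamma> y u w" for v w
    by (rule metric_eqI[OF y])
       (simp add: linear_add[OF lin(1)] linear_add[OF lin(2)] linear_add[OF lin(3)]
         linear_add[OF lin(4)] metric_christoffel y koszul_def algebra_simps)
  show "\<Gamma> y u (c *\<^sub>R v) = c *\<^sub>R \<Gamma> y u v" for c v
    by (rule metric_eqI[OF y])
       (simp add: linear_scale[OF lin(1)] linear_scale[OF lin(2)] linear_scale[OF lin(3)]
         linear_scale[OF lin(4)] metric_christoffel y koszul_def algebra_simps)
qed

lemma linear_christoffel_left: "y \<in> S \<Longrightarrow> linear (\<lambda>u. \<Gamma> y u v)"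
  using linear_christoffel by (simp add: christoffel_commute[of y _ v])

lemma smooth_christoffel: "smooth_on (\<lambda>y. \<Gamma> y u v) S"
proof -
  have smooth_neg: "smooth_on (\<lambda>y. - k y) S" if "smooth_on k S" for k :: "'e \<Rightarrow> real"
    using that smooth_on_bounded_linear[OF open_domain bounded_linear_minus[OF bounded_linear_ident]]
    by blast
  have "smooth_on (\<lambda>y. (1/2::real) *\<^sub>R (dir_deriv (\<lambda>y'. G y' v z) y u + dir_deriv (\<lambda>y'. G y' u z) y v
     + - dir_deriv (\<lambda>y'. G y' u v) y z)) S" for z
    by (rule smooth_on_scaleR[OF open_domain smooth_on_const[OF open_domain]])
       (intro smooth_on_add open_domain smooth_neg smooth_on_dir_deriv smooth)
  then have "smooth_on (\<lambda>y. koszul y u v z) S" for z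
    by (simp add: koszul_def)
  then show ?thesis
    by (subst smooth_on_cong[OF open_domain christoffel_sharp]) (auto intro: smooth_sharp)
qed

text \<open>The Levi-Civita connection is metric: adding the Koszul formulas for \<open>(u,v,w)\<close> and \<open>(u,w,v)\<close> leaves
  only the derivative in direction \<open>u\<close>.\<close>

lemma metric_compatible:
  assumes y: "y \<in> S"
  shows "dir_deriv (\<lambda>y. G y v w) y u = G y (\<Gamma> y u v) w + G y v (\<Gamma> y u w)"
proof -
  have "dir_deriv (\<lambda>y. G y w v) y = dir_deriv (\<lambda>y. G y v w) y"
    by (rule dir_deriv_cong[OF open_domain y symmetric])
  moreover have "G y v (\<Gamma> y u w) = G y (\<Gamma> y u w) v" by (rule symmetric[OF y])
  ultimately show ?thesis
    unfolding metric_christoffel[OF y] koszul_def by (simp add: field_simps)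
qed

definition grad :: "('e \<Rightarrow> real) \<Rightarrow> 'e \<Rightarrow> 'e" where
  "grad F y = sharp y (dir_deriv F y)"

lemma smooth_grad: "smooth_on F S \<Longrightarrow> smooth_on (grad F) S"
  unfolding grad_def by (intro smooth_sharp smooth_on_dir_deriv)

lemma metric_grad: "smooth_on F S \<Longrightarrow> y \<in> S \<Longrightarrow> G y (grad F y) z = dir_deriv F y z"
  unfolding grad_def by (intro metric_sharp linear_dir_deriv smooth_on_differentiable)

text \<open>The Hessian is the covariant derivative of the gradient. Working with the gradient rather than
  with second derivatives of \<open>F\<close> makes the curvature appear by itself in \<open>riemann_grad\<close>.\<close>

lemma coord_hessian_grad:
  assumes F: "smooth_on F S" and y: "y \<in> S"
  shows "coord_hessian G F y u v = G y (dir_deriv (grad F) y u + \<Gamma> y u (grad F y)) v"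
proof -
  have "dir_deriv (\<lambda>y'. dir_deriv F y' v) y u = dir_deriv (\<lambda>y'. G y' (grad F y') v) y u"
    by (subst dir_deriv_cong[OF open_domain y]) (simp_all add: metric_grad[OF F])
  also have "\<dots> = dir_deriv (\<lambda>y'. G y' (grad F y) v) y u + G y (dir_deriv (grad F) y u) v"
    by (rule dir_deriv_linear_family[where M = "\<lambda>y w. G y w v", OF open_domain y])
       (simp_all add: linear_left smooth_on_differentiable[OF smooth y]
         smooth_on_differentiable[OF smooth_grad[OF F] y])
  also have "dir_deriv (\<lambda>y'. G y' (grad F y) v) y u
      = G y (\<Gamma> y u (grad F y)) v + dir_deriv F y (\<Gamma> y u v)"
    by (simp add: metric_compatible[OF y] metric_grad[OF F y])
  finally show ?thesis
    by (simp add: coord_hessian_def linear_add[OF linear_left[OF y]])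
qed

end

text \<open>Functions whose Hessian is pointwise proportional to the metric are called concircular; \<open>h\<close> is
  the factor of proportionality.\<close>

locale concircular_function = coordinate_metric S G
  for S :: "'e::euclidean_space set" and G +
  fixes F h :: "'e \<Rightarrow> real"
  assumes smooth_function: "smooth_on F S"
    and hessian_eq: "y \<in> S \<Longrightarrow> coord_hessian G F y u v = h y * G y u v"
begin

abbreviation N :: "'e \<Rightarrow> 'e" where "N \<equiv> grad F"

lemma grad_deriv:
  assumes y: "y \<in> S"
  shows "dir_deriv N y u = h y *\<^sub>R u - \<Gamma> y u (N y)"
proof -
  have "dir_deriv N y u + \<Gamma> y u (N y) = h y *\<^sub>R u"
    by (rule metric_eqI[OF y])
       (simp add: hessian_eq[OF y] coord_hessian_grad[OF smooth_function y, symmetric]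
         linear_scale[OF linear_left[OF y]])
  then show ?thesis by (simp add: algebra_simps)
qed

lemma smooth_christoffel_grad: "smooth_on (\<lambda>y. \<Gamma> y u (N y)) S"
  by (rule smooth_on_linear_family[OF open_domain])
     (auto intro: linear_christoffel smooth_christoffel smooth_grad smooth_function)

text \<open>The factor is recovered from the gradient as a component of \<open>\<nabla>\<^sub>b N = h b\<close> for a basis vector \<open>b\<close>.\<close>

lemma smooth_factor: "smooth_on h S"
proof -
  obtain b :: 'e where b: "b \<in> Basis" using nonempty_Basis by blast
  have "smooth_on (\<lambda>y. (dir_deriv N y b + \<Gamma> y b (N y)) \<bullet> b) S"
    by (intro smooth_on_bounded_linear[OF open_domain bounded_linear_inner_left]
         smooth_on_add[OF open_domain] smooth_on_dir_deriv smooth_christoffel_grad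
         smooth_grad smooth_function)
  then show ?thesis
    by (subst smooth_on_cong[OF open_domain, where G = "\<lambda>y. (dir_deriv N y b + \<Gamma> y b (N y)) \<bullet> b"])
       (simp_all add: grad_deriv b)
qed

text \<open>The Ricci identity: differentiate \<open>D\<^sub>u N = h u - \<Gamma>(u,N)\<close> along \<open>z\<close> and use that \<open>D\<^sub>z D\<^sub>u N\<close> is symmetric
  in \<open>u\<close> and \<open>z\<close>.\<close>

lemma riemann_grad:
  assumes y: "y \<in> S"
  shows "coord_riemann G y z u (N y) = dir_deriv h y z *\<^sub>R u - dir_deriv h y u *\<^sub>R z"
proof -
  note N = smooth_grad[OF smooth_function]
  have second: "dir_deriv (\<lambda>y. dir_deriv N y u) y z =
      dir_deriv h y z *\<^sub>R u - (dir_deriv (\<lambda>y'. \<Gamma> y' u (N y)) y z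
        + (h y *\<^sub>R \<Gamma> y u z - \<Gamma> y u (\<Gamma> y z (N y))))" for u z
  proof -
    have "((\<lambda>y. h y *\<^sub>R u) has_derivative (\<lambda>k. dir_deriv h y k *\<^sub>R u)) (at y)"
      by (intro has_derivative_scaleR_left smooth_on_has_derivative[OF smooth_factor y])
    moreover have "((\<lambda>y. \<Gamma> y u (N y)) has_derivative
        (\<lambda>k. dir_deriv (\<lambda>y'. \<Gamma> y' u (N y)) y k + \<Gamma> y u (dir_deriv N y k))) (at y)"
      by (rule has_derivative_linear_family[OF open_domain y])
         (simp_all add: linear_christoffel smooth_on_differentiable[OF smooth_christoffel y]
           smooth_on_has_derivative[OF N y])
    ultimately have "((\<lambda>y. h y *\<^sub>R u - \<Gamma> y u (N y)) has_derivative (\<lambda>k. dir_deriv h y k *\<^sub>R u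
        - (dir_deriv (\<lambda>y'. \<Gamma> y' u (N y)) y k + \<Gamma> y u (dir_deriv N y k)))) (at y)"
      by (rule has_derivative_diff)
    then have "dir_deriv (\<lambda>y. h y *\<^sub>R u - \<Gamma> y u (N y)) y z = dir_deriv h y z *\<^sub>R u
        - (dir_deriv (\<lambda>y'. \<Gamma> y' u (N y)) y z + \<Gamma> y u (dir_deriv N y z))"
      by (rule dir_deriv_eq)
    moreover have "dir_deriv (\<lambda>y. dir_deriv N y u) y z = dir_deriv (\<lambda>y. h y *\<^sub>R u - \<Gamma> y u (N y)) y z"
      by (subst dir_deriv_cong[OF open_domain y]) (simp_all add: grad_deriv)
    ultimately show ?thesis
      by (simp add: grad_deriv[OF y] linear_diff[OF linear_christoffel[OF y]]
        linear_scale[OF linear_christoffel[OF y]])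
  qed
  have "dir_deriv (\<lambda>y. dir_deriv N y u) y z = dir_deriv (\<lambda>y. dir_deriv N y z) y u"
    by (rule dir_deriv_commute[OF N open_domain y])
  then show ?thesis
    unfolding second coord_riemann_def christoffel_commute[OF y, of z u] by (simp add: algebra_simps)
qed

lemma ricci_grad:
  assumes y: "y \<in> S"
  shows "coord_ricci G y v (N y) = (1 - real DIM('e)) * dir_deriv h y v"
proof -
  have "coord_ricci G y v (N y)
      = (\<Sum>b\<in>Basis. (v \<bullet> b) *\<^sub>R dir_deriv h y b - dir_deriv h y v * (b \<bullet> b))"
    by (simp add: coord_ricci_def lin_trace_def riemann_grad[OF y] inner_diff_left mult.commute)
  also have "\<dots> = dir_deriv h y v - real DIM('e) * dir_deriv h y v"
    using linear_basis_expansion[OF linear_dir_deriv[OF smooth_on_differentiable[OF smooth_factor y]], of v]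
    by (simp add: sum_subtractf)
  finally show ?thesis by (simp add: algebra_simps)
qed

end

section \<open>The static metric over a concircular function\<close>

lemma has_derivative_compose_fst:
  assumes "(K has_derivative K') (at y)"
  shows "((\<lambda>q. K (fst q)) has_derivative (\<lambda>k. K' (fst k))) (at (y, t))"
proof (rule has_derivative_compose[of fst fst])
  show "(fst has_derivative fst) (at (y, t))"
    using has_derivative_fst[OF has_derivative_ident] by blast
  show "(K has_derivative K') (at (fst (y, t)))" using assms by simp
qed

lemma lin_trace_prod:
  "lin_trace L = lin_trace (\<lambda>u. fst (L (u, 0))) + snd (L (0, 1))"
  for L :: "'e::euclidean_space \<times> real \<Rightarrow> 'e \<times> real"
  unfolding lin_trace_def Basis_prod_def
  by (subst sum.union_disjoint) (auto simp: Basis_prod_def sum.reindex inj_on_def inner_prod_def)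

locale static_chart = concircular_function S G F h
  for S :: "'e::euclidean_space set" and G F h +
  fixes Gt :: "'e \<times> real \<Rightarrow> 'e \<times> real \<Rightarrow> 'e \<times> real \<Rightarrow> real"
  assumes positive: "y \<in> S \<Longrightarrow> 0 < F y"
    and static_metric_eq: "y \<in> S \<Longrightarrow>
      Gt (y, t) U V = G y (fst U) (fst V) - (F y)\<^sup>2 * (snd U * snd V)"
begin

lemma open_static_domain: "open (S \<times> (UNIV :: real set))"
  by (intro open_Times open_domain open_UNIV)

lemma differentiable_F: "y \<in> S \<Longrightarrow> F differentiable (at y)"
  by (rule smooth_on_differentiable[OF smooth_function])

lemma linear_dF: "y \<in> S \<Longrightarrow> linear (dir_deriv F y)"
  by (rule linear_dir_deriv[OF differentiable_F])

lemma static_metric_eqI: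
  assumes y: "y \<in> S" and eq: "\<And>Z. Gt (y, t) w Z = Gt (y, t) w' Z"
  shows "w = w'"
proof (rule prod_eqI)
  have "G y (fst w) z = G y (fst w') z" for z
    using eq[of "(z, 0)"] by (simp add: static_metric_eq[OF y])
  then show "fst w = fst w'" by (rule metric_eqI[OF y])
  show "snd w = snd w'"
    using eq[of "(0, 1)"] positive[OF y]
    by (simp add: static_metric_eq[OF y] linear_0[OF linear_right[OF y]])
qed

lemma static_metric_deriv:
  assumes y: "y \<in> S"
  shows "dir_deriv (\<lambda>q. Gt q U V) (y, t) Z
    = dir_deriv (\<lambda>y. G y (fst U) (fst V)) y (fst Z)
      - 2 * F y * dir_deriv F y (fst Z) * (snd U * snd V)"
proof -
  note F = smooth_on_has_derivative[OF smooth_function y]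
  have "((\<lambda>y. G y (fst U) (fst V) - (F y * F y) * (snd U * snd V)) has_derivative
      (\<lambda>z. dir_deriv (\<lambda>y. G y (fst U) (fst V)) y z
        - (F y * dir_deriv F y z + dir_deriv F y z * F y) * (snd U * snd V))) (at y)"
    by (intro has_derivative_diff has_derivative_mult_left has_derivative_mult F
         smooth_on_has_derivative[OF smooth y])
  from has_derivative_compose_fst[OF this]
  have "((\<lambda>q. Gt q U V) has_derivative (\<lambda>Z. dir_deriv (\<lambda>y. G y (fst U) (fst V)) y (fst Z)
      - (F y * dir_deriv F y (fst Z) + dir_deriv F y (fst Z) * F y) * (snd U * snd V))) (at (y, t))"
    by (rule has_derivative_transform_within_open[OF _ open_static_domain])
       (use y in \<open>auto simp: static_metric_eq power2_eq_square\<close>)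
  from dir_deriv_eq[OF this, of Z] show ?thesis by (simp add: algebra_simps)
qed

text \<open>The slices are totally geodesic, and \<open>\<nabla>\<^sub>t \<partial>\<^sub>t = F N\<close> points in the direction of
  the acceleration of a static observer.\<close>

lemma static_christoffel:
  assumes y: "y \<in> S"
  shows "christoffel Gt (y, t) U V =
    (\<Gamma> y (fst U) (fst V) + (snd U * snd V * F y) *\<^sub>R N y,
     (dir_deriv F y (fst U) * snd V + dir_deriv F y (fst V) * snd U) / F y)"
    (is "_ = ?w")
proof (rule christoffel_eqI)
  show "w = w'" if "\<And>z. Gt (y, t) w z = Gt (y, t) w' z" for w w'
    by (rule static_metric_eqI[OF y that])
  show "2 * Gt (y, t) ?w Z = dir_deriv (\<lambda>q. Gt q V Z) (y, t) U + dir_deriv (\<lambda>q. Gt q U Z) (y, t) V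
      - dir_deriv (\<lambda>q. Gt q U V) (y, t) Z" for Z
  proof -
    have "G y (fst ?w) (fst Z) = koszul y (fst U) (fst V) (fst Z)
        + snd U * snd V * F y * dir_deriv F y (fst Z)"
      by (simp add: linear_add[OF linear_left[OF y]] linear_scale[OF linear_left[OF y]]
          metric_christoffel[OF y] metric_grad[OF smooth_function y])
    moreover have "(F y)\<^sup>2 * (snd ?w * snd Z)
        = F y * ((dir_deriv F y (fst U) * snd V + dir_deriv F y (fst V) * snd U) * snd Z)"
      using positive[OF y] by (simp add: power2_eq_square)
    ultimately show ?thesis
      unfolding static_metric_eq[OF y] static_metric_deriv[OF y] koszul_def
      by (simp add: algebra_simps)
  qed
qed

text \<open>The Christoffel symbols are time independent, so their derivative sees the spatial part of the
  direction only.\<close>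

lemma static_christoffel_deriv:
  assumes y: "y \<in> S"
  shows "dir_deriv (\<lambda>q. christoffel Gt q V W) (y, t) Z =
    (dir_deriv (\<lambda>y. \<Gamma> y (fst V) (fst W)) y (fst Z)
       + (snd V * snd W) *\<^sub>R (F y *\<^sub>R dir_deriv N y (fst Z) + dir_deriv F y (fst Z) *\<^sub>R N y),
     (dir_deriv (\<lambda>y. dir_deriv F y (fst V)) y (fst Z) * snd W
       + dir_deriv (\<lambda>y. dir_deriv F y (fst W)) y (fst Z) * snd V) / F y
     - (dir_deriv F y (fst V) * snd W + dir_deriv F y (fst W) * snd V) * dir_deriv F y (fst Z)
         / (F y * F y))"
proof -
  note F = smooth_on_has_derivative[OF smooth_function y]
  note dF = smooth_on_has_derivative[OF smooth_on_dir_deriv[OF smooth_function] y]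
  let ?v = "fst V" and ?w = "fst W" and ?b = "snd V" and ?c = "snd W"
  let ?A = "\<lambda>y. dir_deriv F y ?v * ?c + dir_deriv F y ?w * ?b"
  let ?A' = "\<lambda>z. dir_deriv (\<lambda>y. dir_deriv F y ?v) y z * ?c + dir_deriv (\<lambda>y. dir_deriv F y ?w) y z * ?b"
  have space: "((\<lambda>y. \<Gamma> y ?v ?w + (?b * ?c) *\<^sub>R (F y *\<^sub>R N y)) has_derivative
      (\<lambda>z. dir_deriv (\<lambda>y. \<Gamma> y ?v ?w) y z
        + (?b * ?c) *\<^sub>R (F y *\<^sub>R dir_deriv N y z + dir_deriv F y z *\<^sub>R N y))) (at y)"
    by (intro has_derivative_add has_derivative_scaleR_right has_derivative_scaleR F
         smooth_on_has_derivative[OF smooth_christoffel y]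
         smooth_on_has_derivative[OF smooth_grad[OF smooth_function] y])
  have A: "(?A has_derivative ?A') (at y)"
    by (intro has_derivative_add has_derivative_mult_left dF)
  have time: "((\<lambda>y. ?A y / F y) has_derivative
      (\<lambda>z. ?A' z / F y - ?A y * dir_deriv F y z / (F y * F y))) (at y)"
    by (rule has_derivative_eq_rhs[OF has_derivative_divide[OF A F]])
       (use positive[OF y] in \<open>auto simp: fun_eq_iff field_simps\<close>)
  from has_derivative_compose_fst[OF has_derivative_Pair[OF space time], of t]
  have "((\<lambda>q. christoffel Gt q V W) has_derivative (\<lambda>Z.
     (dir_deriv (\<lambda>y. \<Gamma> y ?v ?w) y (fst Z)
        + (?b * ?c) *\<^sub>R (F y *\<^sub>R dir_deriv N y (fst Z) + dir_deriv F y (fst Z) *\<^sub>R N y),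
      ?A' (fst Z) / F y - ?A y * dir_deriv F y (fst Z) / (F y * F y)))) (at (y, t))"
    by (rule has_derivative_transform_within_open[OF _ open_static_domain])
       (use y in \<open>auto simp: static_christoffel\<close>)
  from dir_deriv_eq[OF this, of Z] show ?thesis .
qed

lemma dF_0: "y \<in> S \<Longrightarrow> dir_deriv F y 0 = 0"
  by (rule linear_0[OF linear_dF])

lemma ddF_0: "y \<in> S \<Longrightarrow> dir_deriv (\<lambda>y. dir_deriv F y 0) y v = 0"
  by (subst dir_deriv_cong[OF open_domain, where G = "\<lambda>_. 0"]) (simp_all add: dF_0)

text \<open>For the trace only two diagonal blocks of the curvature are needed: the spatial part of
  \<open>R(e,V)W\<close> and the temporal part of \<open>R(\<partial>\<^sub>t,V)W\<close>.\<close>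

lemma static_riemann_space:
  assumes y: "y \<in> S"
  shows "fst (coord_riemann Gt (y, t) (e, 0) V W)
    = coord_riemann G y e (fst V) (fst W) + (snd V * snd W * F y * h y) *\<^sub>R e"
  using positive[OF y]
  by (simp add: coord_riemann_def static_christoffel[OF y] static_christoffel_deriv[OF y]
      linear_add[OF linear_christoffel[OF y]] linear_scale[OF linear_christoffel[OF y]]
      grad_deriv[OF y] algebra_simps)

lemma static_riemann_time:
  assumes y: "y \<in> S"
  shows "snd (coord_riemann Gt (y, t) (0, 1) V W) = - (h y / F y) * G y (fst V) (fst W)"
proof -
  let ?v = "fst V" and ?w = "fst W"
  have hess: "dir_deriv (\<lambda>y. dir_deriv F y ?w) y ?v = h y * G y ?v ?w + dir_deriv F y (\<Gamma> y ?v ?w)"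
    using hessian_eq[OF y, of ?v ?w] by (simp add: coord_hessian_def)
  have zero: "dir_deriv (\<lambda>y. dir_deriv F y u) y 0 = 0" for u
    by (rule linear_0[OF linear_dir_deriv[OF smooth_on_differentiable[OF
          smooth_on_dir_deriv[OF smooth_function] y]]])
  show ?thesis
    using positive[OF y]
    by (simp add: coord_riemann_def static_christoffel[OF y] static_christoffel_deriv[OF y]
        dF_0[OF y] ddF_0[OF y] zero hess linear_0[OF linear_christoffel_left[OF y]]
        linear_add[OF linear_dF[OF y]] linear_scale[OF linear_dF[OF y]] field_simps)
qed

lemma static_ricci:
  assumes y: "y \<in> S"
  shows "coord_ricci Gt (y, t) V W = coord_ricci G y (fst V) (fst W)
    + real DIM('e) * h y * F y * (snd V * snd W) - h y / F y * G y (fst V) (fst W)"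
proof -
  have "coord_ricci Gt (y, t) V W
    = (\<Sum>e\<in>Basis. (coord_riemann G y e (fst V) (fst W) + (snd V * snd W * F y * h y) *\<^sub>R e) \<bullet> e)
      - h y / F y * G y (fst V) (fst W)"
    by (simp add: coord_ricci_def lin_trace_prod static_riemann_space[OF y]
        static_riemann_time[OF y] lin_trace_def)
  also have "(\<Sum>e\<in>Basis. (coord_riemann G y e (fst V) (fst W) + (snd V * snd W * F y * h y) *\<^sub>R e) \<bullet> e)
    = coord_ricci G y (fst V) (fst W) + real DIM('e) * h y * F y * (snd V * snd W)"
    by (simp add: coord_ricci_def lin_trace_def inner_add_left sum.distrib)
  finally show ?thesis .
qed

end

section \<open>Rigidity of solitons\<close>

lemma has_derivative_slice_fst:
  assumes "K differentiable (at (y, t))"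
  shows "((\<lambda>y. K (y, t)) has_derivative (\<lambda>u. dir_deriv K (y, t) (u, 0))) (at y)"
  by (rule has_derivative_compose[of "\<lambda>y. (y, t)" "\<lambda>u. (u, 0)", OF _ has_dir_deriv[OF assms]])
     (auto intro!: derivative_eq_intros)

lemma has_derivative_slice_snd:
  assumes "K differentiable (at (y, t))"
  shows "((\<lambda>t. K (y, t)) has_derivative (\<lambda>s. dir_deriv K (y, t) (0, s))) (at t)"
  by (rule has_derivative_compose[of "\<lambda>t. (y, t)" "\<lambda>s. (0, s)", OF _ has_dir_deriv[OF assms]])
     (auto intro!: derivative_eq_intros)

lemma Ck_on_slice:
  assumes "open S" "Ck_on k K (S \<times> UNIV)"
  shows "Ck_on k (\<lambda>y. K (y, t)) S"
  using assms(2)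
proof (induction k arbitrary: K)
  case 0
  then have "continuous_on (S \<times> UNIV) K" by simp
  then have "continuous_on S (\<lambda>y. K (y, t))"
    by (rule continuous_on_compose2) (auto intro: continuous_intros)
  then show ?case by simp
next
  case (Suc k)
  show ?case
  proof (rule Ck_on_SucI[OF assms(1)])
    show "((\<lambda>y. K (y, t)) has_derivative (\<lambda>u. dir_deriv K (y, t) (u, 0))) (at y)" if "y \<in> S" for y
      using Suc.prems that by (intro has_derivative_slice_fst) simp
    show "Ck_on k (\<lambda>y. dir_deriv K (y, t) (u, 0)) S" for u
      using Suc.prems by (intro Suc.IH) simp
  qed
qed

lemma smooth_on_slice:
  "open S \<Longrightarrow> smooth_on K (S \<times> UNIV) \<Longrightarrow> smooth_on (\<lambda>y. K (y, t)) S"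
  unfolding smooth_on_def using Ck_on_slice by blast

lemma coord_hessian_cong:
  assumes "open B" "y \<in> B" "\<And>x. x \<in> B \<Longrightarrow> K x = K' x"
  shows "coord_hessian G K y u v = coord_hessian G K' y u v"
proof -
  have "dir_deriv K x = dir_deriv K' x" if "x \<in> B" for x
    by (rule dir_deriv_cong[OF assms(1) that]) (rule assms(3))
  then have "dir_deriv (\<lambda>x. dir_deriv K x v) y = dir_deriv (\<lambda>x. dir_deriv K' x v) y"
    and "dir_deriv K y = dir_deriv K' y"
    using dir_deriv_cong[OF assms(1,2), of "\<lambda>x. dir_deriv K x v"] assms(2) by auto
  then show ?thesis by (simp add: coord_hessian_def)
qed

lemma coord_hessian_lincomb:
  assumes K: "smooth_on K S" and K': "smooth_on K' S" and S: "open S" "y \<in> S"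
  shows "coord_hessian G (\<lambda>y. K y * c + K' y) y u v
    = c * coord_hessian G K y u v + coord_hessian G K' y u v"
proof -
  have d: "dir_deriv (\<lambda>y. K y * c + K' y) y u = dir_deriv K y u * c + dir_deriv K' y u"
    if "smooth_on K S" "smooth_on K' S" "y \<in> S" for K K' :: "'a \<Rightarrow> real" and y u
    by (rule dir_deriv_eq)
       (intro has_derivative_add has_derivative_mult_left smooth_on_has_derivative[OF that(1,3)]
         smooth_on_has_derivative[OF that(2,3)])
  have "dir_deriv (\<lambda>y. dir_deriv (\<lambda>y. K y * c + K' y) y v) y u
    = dir_deriv (\<lambda>y. dir_deriv K y v * c + dir_deriv K' y v) y u"
    by (subst dir_deriv_cong[OF S]) (simp_all add: d[OF K K'])
  then show ?thesis
    unfolding coord_hessian_def d[OF K K' S(2)]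
      d[OF smooth_on_dir_deriv[OF K] smooth_on_dir_deriv[OF K'] S(2)]
    by (simp add: algebra_simps)
qed

context concircular_function
begin

text \<open>Follows from \<open>\<nabla>\<^sub>u N = h u\<close>. For \<open>K = F\<close> it differentiates \<open>|\<nabla>F|\<^sup>2\<close>; for \<open>K\<close> with zero Hessian only
  the term with \<open>h\<close> remains.\<close>

lemma deriv_along_grad:
  assumes K: "smooth_on K S" and y: "y \<in> S"
  shows "dir_deriv (\<lambda>y. dir_deriv K y (N y)) y u
    = coord_hessian G K y u (N y) + h y * dir_deriv K y u"
proof -
  have lin: "linear (dir_deriv K y)" if "y \<in> S" for y
    by (rule linear_dir_deriv[OF smooth_on_differentiable[OF K that]])
  have "dir_deriv (\<lambda>y. dir_deriv K y (N y)) y u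
    = dir_deriv (\<lambda>x. dir_deriv K x (N y)) y u + dir_deriv K y (dir_deriv N y u)"
    by (rule dir_deriv_linear_family[OF open_domain y])
       (simp_all add: lin smooth_on_differentiable[OF smooth_on_dir_deriv[OF K] y]
         smooth_on_differentiable[OF smooth_grad[OF smooth_function] y])
  then show ?thesis
    by (simp add: grad_deriv[OF y] linear_diff[OF lin[OF y]] linear_scale[OF lin[OF y]] coord_hessian_def)
qed

end

text \<open>The hypotheses of the theorem in one chart; \<open>P\<close> is the potential of the soliton.\<close>

locale static_soliton_chart = static_chart S G F h Gt
  for S :: "'e::euclidean_space set" and G F h Gt +
  fixes P lam :: "'e \<times> real \<Rightarrow> real" and t0 :: real
  assumes dim: "2 \<le> DIM('e)"
    and ricci_flat: "y \<in> S \<Longrightarrow> coord_ricci G y u v = 0"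
    and smooth_potential: "smooth_on P (S \<times> UNIV)"
    and soliton: "y \<in> S \<Longrightarrow>
      coord_hessian Gt P (y, t) U V + coord_ricci Gt (y, t) U V + lam (y, t) * Gt (y, t) U V = 0"
    and hessian_slice: "y \<in> S \<Longrightarrow> coord_hessian G (\<lambda>y. P (y, t0)) y u v = 0"
begin

text \<open>\<open>ricci_grad\<close> has the coefficient \<open>1 - n\<close>, which is nonzero in dimension at least two.\<close>

lemma factor_deriv: "y \<in> S \<Longrightarrow> dir_deriv h y u = 0"
  using ricci_grad[of y u] ricci_flat[of y u "N y"] dim by simp

lemma potential_diff: "y \<in> S \<Longrightarrow> P differentiable (at (y, t))"
  by (rule smooth_on_differentiable[OF smooth_potential]) simp

lemma linear_potential_deriv: "y \<in> S \<Longrightarrow> linear (dir_deriv P (y, t))"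
  by (rule linear_dir_deriv[OF potential_diff])

lemma smooth_potential_slice: "smooth_on (\<lambda>y. P (y, t)) S"
  by (rule smooth_on_slice[OF open_domain smooth_potential])

lemma slice_deriv: "y \<in> S \<Longrightarrow> dir_deriv P (y, t) (u, 0) = dir_deriv (\<lambda>y. P (y, t)) y u"
  using dir_deriv_eq[OF has_derivative_slice_fst[OF potential_diff]] by simp

abbreviation P\<^sub>t :: "'e \<times> real \<Rightarrow> real" where
  "P\<^sub>t \<equiv> \<lambda>q. dir_deriv P q (0, 1)"

lemma time_deriv_diff: "y \<in> S \<Longrightarrow> P\<^sub>t differentiable (at (y, t))"
  by (rule smooth_on_differentiable[OF smooth_on_dir_deriv[OF smooth_potential]]) simp

text \<open>The three blocks of the soliton equation follow. In the mixed block both the metric and the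
  Ricci tensor vanish, which leaves an equation for \<open>P\<^sub>t\<close> alone.\<close>

lemma soliton_space_time:
  assumes y: "y \<in> S"
  shows "dir_deriv P\<^sub>t (y, t) (u, 0) = P\<^sub>t (y, t) * dir_deriv F y u / F y"
proof -
  have "dir_deriv P (y, t) (0, dir_deriv F y u / F y) = dir_deriv F y u / F y * P\<^sub>t (y, t)"
    using linear_scale[OF linear_potential_deriv[OF y], of t "dir_deriv F y u / F y" "(0, 1)"] by simp
  moreover have "G y u 0 = 0" "\<Gamma> y u 0 = 0"
    using linear_0[OF linear_right[OF y]] linear_0[OF linear_christoffel[OF y]] by auto
  ultimately show ?thesis
    using soliton[OF y, of t "(u, 0)" "(0, 1)"]
    by (simp add: coord_hessian_def static_christoffel[OF y] static_ricci[OF y] ricci_flat[OF y]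
        static_metric_eq[OF y])
qed

lemma soliton_space:
  assumes y: "y \<in> S"
  shows "coord_hessian G (\<lambda>y. P (y, t)) y u v = (h y / F y - lam (y, t)) * G y u v"
proof -
  have "dir_deriv (\<lambda>q. dir_deriv P q (v, 0)) (y, t) (u, 0)
    = dir_deriv (\<lambda>y. dir_deriv P (y, t) (v, 0)) y u"
    using dir_deriv_eq[OF has_derivative_slice_fst[OF smooth_on_differentiable[OF
      smooth_on_dir_deriv[OF smooth_potential]]]] y by simp
  also have "\<dots> = dir_deriv (\<lambda>y. dir_deriv (\<lambda>y. P (y, t)) y v) y u"
    by (subst dir_deriv_cong[OF open_domain y]) (simp_all add: slice_deriv)
  finally have "coord_hessian Gt P (y, t) (u, 0) (v, 0) = coord_hessian G (\<lambda>y. P (y, t)) y u v"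
    by (simp add: coord_hessian_def static_christoffel[OF y] slice_deriv[OF y])
  then show ?thesis
    using soliton[OF y, of t "(u, 0)" "(v, 0)"]
    by (simp add: static_ricci[OF y] ricci_flat[OF y] static_metric_eq[OF y] algebra_simps)
qed

lemma soliton_time:
  assumes y: "y \<in> S"
  shows "dir_deriv P\<^sub>t (y, t) (0, 1) - F y * dir_deriv (\<lambda>y. P (y, t)) y (N y)
    + real DIM('e) * h y * F y - lam (y, t) * (F y)\<^sup>2 = 0"
proof -
  have "dir_deriv P (y, t) (F y *\<^sub>R N y, 0) = F y * dir_deriv (\<lambda>y. P (y, t)) y (N y)"
    using linear_scale[OF linear_potential_deriv[OF y], of t "F y" "(N y, 0)"]
    by (simp add: slice_deriv[OF y])
  moreover have "G y 0 0 = 0" "\<Gamma> y 0 0 = 0"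
    using linear_0[OF linear_right[OF y]] linear_0[OF linear_christoffel[OF y]] by auto
  ultimately show ?thesis
    using soliton[OF y, of t "(0, 1)" "(0, 1)"]
    by (simp add: coord_hessian_def static_christoffel[OF y] static_ricci[OF y] ricci_flat[OF y]
        static_metric_eq[OF y] dF_0[OF y])
qed

lemma ball_constant:
  fixes k :: "'e \<Rightarrow> real"
  assumes "ball y0 e \<subseteq> S" "\<And>y. y \<in> S \<Longrightarrow> (k has_derivative (\<lambda>_. 0)) (at y)" "y \<in> ball y0 e"
  shows "k y = k y0"
proof (rule has_derivative_zero_unique[where s = "ball y0 e"])
  show "(k has_derivative (\<lambda>h. 0)) (at x within ball y0 e)" if "x \<in> ball y0 e" for x
    using assms(1,2) that by (blast intro: has_derivative_at_withinI)
  show "y0 \<in> ball y0 e" using assms(3) by (metis centre_in_ball dist_nz dist_self mem_ball not_less_iff_gr_or_eq order_less_trans)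
qed (use assms(3) in auto)

lemma factor_constant:
  assumes "ball y0 e \<subseteq> S" "y \<in> ball y0 e"
  shows "h y = h y0"
proof (rule ball_constant[OF assms(1) _ assms(2)])
  show "(h has_derivative (\<lambda>_. 0)) (at y)" if "y \<in> S" for y
    by (rule has_derivative_eq_rhs[OF smooth_on_has_derivative[OF smooth_factor that]])
       (simp add: fun_eq_iff factor_deriv[OF that])
qed

text \<open>By \<open>soliton_space_time\<close> the quotient \<open>P\<^sub>t / F\<close> has zero spatial derivative.\<close>

lemma time_deriv_separated:
  assumes B: "ball y0 e \<subseteq> S" "y \<in> ball y0 e"
  shows "P\<^sub>t (y, t) = F y * (P\<^sub>t (y0, t) / F y0)"
proof -
  have "P\<^sub>t (y, t) / F y = P\<^sub>t (y0, t) / F y0"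
  proof (rule ball_constant[OF B(1) _ B(2)])
    show "((\<lambda>y. P\<^sub>t (y, t) / F y) has_derivative (\<lambda>_. 0)) (at y)" if y: "y \<in> S" for y
      by (rule has_derivative_eq_rhs[OF has_derivative_divide[OF
            has_derivative_slice_fst[OF time_deriv_diff[OF y]]
            smooth_on_has_derivative[OF smooth_function y]]])
         (use positive[OF y] in \<open>auto simp: fun_eq_iff soliton_space_time[OF y] field_simps\<close>)
  qed
  moreover have "0 < F y" using positive B by blast
  ultimately show ?thesis by (simp add: field_simps)
qed

text \<open>Integration of \<open>time_deriv_separated\<close> in time: the two sides have the same derivative in \<open>t\<close> and
  agree at \<open>t0\<close>.\<close>

lemma potential_separated:
  assumes B: "ball y0 e \<subseteq> S" "y \<in> ball y0 e"
  shows "P (y, t) = F y * ((P (y0, t) - P (y0, t0)) / F y0) + P (y, t0)"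
proof -
  have "0 < e" using B(2) le_less_trans[OF zero_le_dist, of y0 y e] by simp
  then have "y0 \<in> ball y0 e" by simp
  then have y: "y \<in> S" and y0: "y0 \<in> S" using B subsetD[OF B(1)] by simp_all
  let ?k = "\<lambda>t. P (y, t) - F y * ((P (y0, t) - P (y0, t0)) / F y0)"
  have time: "((\<lambda>t. P (z, t)) has_real_derivative P\<^sub>t (z, t)) (at t)" if "z \<in> S" for z t
  proof -
    have scale: "dir_deriv P (z, t) (0, s) = P\<^sub>t (z, t) * s" for s
      using linear_scale[OF linear_potential_deriv[OF that], of t s "(0, 1)"] by (simp add: mult.commute)
    have "((\<lambda>t. P (z, t)) has_derivative (\<lambda>s. P\<^sub>t (z, t) * s)) (at t)"
      by (rule has_derivative_eq_rhs[OF has_derivative_slice_snd[OF potential_diff[OF that]]])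
         (rule ext, rule scale)
    then show ?thesis by (rule has_derivative_imp_has_field_derivative) simp
  qed
  have "(?k has_real_derivative P\<^sub>t (y, t) - F y * ((P\<^sub>t (y0, t) - 0) / F y0)) (at t)" for t
    by (rule DERIV_diff[OF time[OF y] DERIV_cmult[OF DERIV_cdivide[OF DERIV_diff[OF time[OF y0] DERIV_const]]]])
  then have "(?k has_real_derivative 0) (at t)" for t
    by (simp only: time_deriv_separated[OF B] diff_0_right diff_self)
  then have "?k t = ?k t0" using DERIV_isconst_all[of ?k t t0] by blast
  then show ?thesis by simp
qed

text \<open>The core of the argument. All equations hold at every point \<open>y\<close> of a ball around \<open>y0\<close> and at
  every time, with the coefficients \<open>b\<close> and \<open>a = b''\<close> depending on the time only. The spatial derivative
  of the scalar equation removes \<open>a\<close> and the constant term, and relates the gradients of \<open>F\<close> and of the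
  slice potential.\<close>

lemma factor_zero:
  assumes y0: "y0 \<in> S"
  shows "h y0 = 0"
proof (rule ccontr)
  assume k: "h y0 \<noteq> 0"
  obtain e where e: "0 < e" "ball y0 e \<subseteq> S" using open_domain y0 openE by blast
  define B where "B = ball y0 e"
  have B: "open B" "y0 \<in> B" "\<And>y. y \<in> B \<Longrightarrow> y \<in> S"
    using e by (auto simp: B_def)
  have h: "h y = h y0" if "y \<in> B" for y
    by (rule factor_constant[OF e(2) that[unfolded B_def]])
  define b where "b t = (P (y0, t) - P (y0, t0)) / F y0" for t
  define a where "a t = dir_deriv P\<^sub>t (y0, t) (0, 1) / F y0" for t
  let ?P0 = "\<lambda>y. P (y, t0)"
  have P: "P (y, t) = F y * b t + ?P0 y" if "y \<in> B" for y t
    unfolding b_def by (rule potential_separated[OF e(2) that[unfolded B_def]])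
  have P_tt: "dir_deriv P\<^sub>t (y, t) (0, 1) = F y * a t" if "y \<in> B" for y t
  proof -
    have "((\<lambda>t. F y * (P\<^sub>t (y0, t) / F y0)) has_derivative
        (\<lambda>s. F y * (dir_deriv P\<^sub>t (y0, t) (0, s) / F y0))) (at t)"
      by (rule has_derivative_mult_right)
         (rule bounded_linear.has_derivative[OF bounded_linear_divide
            has_derivative_slice_snd[OF time_deriv_diff[OF y0]]])
    moreover have "(\<lambda>t. P\<^sub>t (y, t)) = (\<lambda>t. F y * (P\<^sub>t (y0, t) / F y0))"
      by (rule ext) (rule time_deriv_separated[OF e(2) that[unfolded B_def]])
    ultimately have "dir_deriv (\<lambda>t. P\<^sub>t (y, t)) t 1 = F y * (dir_deriv P\<^sub>t (y0, t) (0, 1) / F y0)"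
      by (simp only: dir_deriv_eq)
    then have "dir_deriv (\<lambda>t. P\<^sub>t (y, t)) t 1 = F y * a t" by (simp only: a_def)
    then show ?thesis
      using dir_deriv_eq[OF has_derivative_slice_snd[OF time_deriv_diff[OF B(3)[OF that]]]] by simp
  qed
  have dP: "dir_deriv (\<lambda>y. P (y, t)) y u = dir_deriv F y u * b t + dir_deriv ?P0 y u"
    if "y \<in> B" for y t u
  proof -
    have "((\<lambda>y. F y * b t + ?P0 y) has_derivative (\<lambda>u. dir_deriv F y u * b t + dir_deriv ?P0 y u)) (at y)"
      by (rule has_derivative_add[OF has_derivative_mult_left[OF smooth_on_has_derivative[OF
            smooth_function B(3)[OF that]]] smooth_on_has_derivative[OF smooth_potential_slice B(3)[OF that]]])
    moreover have "dir_deriv (\<lambda>y. P (y, t)) y = dir_deriv (\<lambda>y. F y * b t + ?P0 y) y"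
      by (rule dir_deriv_cong[OF B(1) that P])
    ultimately show ?thesis by (simp only: dir_deriv_eq)
  qed
  have lam: "lam (y, t) = h y0 / F y - b t * h y0" if "y \<in> B" for y t
  proof -
    note y = B(3)[OF that]
    obtain b' :: 'e where "b' \<in> Basis" using nonempty_Basis by blast
    then obtain v where v: "G y b' v \<noteq> 0" using nondegenerate[OF y] nonzero_Basis by blast
    have "coord_hessian G (\<lambda>y. P (y, t)) y b' v = coord_hessian G (\<lambda>y. F y * b t + ?P0 y) y b' v"
      by (rule coord_hessian_cong[OF B(1) that P])
    also have "\<dots> = b t * (h y * G y b' v)"
      by (simp add: coord_hessian_lincomb[OF smooth_function smooth_potential_slice open_domain y]
          hessian_slice[OF y] hessian_eq[OF y])
    finally show ?thesis using v by (simp add: soliton_space[OF y] h[OF that])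
  qed
  \<comment> \<open>the time component divided by \<open>F\<close>, after elimination of \<open>lam\<close>\<close>
  have scalar: "a t - (b t * dir_deriv F y (N y) + dir_deriv ?P0 y (N y))
      + (real DIM('e) - 1) * h y0 + b t * h y0 * F y = 0" if "y \<in> B" for y t
  proof -
    have lam2: "lam (y, t) * (F y)\<^sup>2 = F y * (h y0 - b t * h y0 * F y)"
      using positive[OF B(3)[OF that]] by (simp add: lam[OF that] power2_eq_square field_simps)
    have "F y * (a t - (b t * dir_deriv F y (N y) + dir_deriv ?P0 y (N y))
      + (real DIM('e) - 1) * h y0 + b t * h y0 * F y) = 0"
      using soliton_time[OF B(3)[OF that], of t]
      unfolding P_tt[OF that] dP[OF that, of t] h[OF that] lam2 by (simp add: algebra_simps)
    then show ?thesis using positive[OF B(3)[OF that]] by simp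
  qed
  \<comment> \<open>the derivative of \<open>b |N|\<^sup>2\<close> is twice that of \<open>b h F\<close>, so the two do not cancel\<close>
  have key: "dir_deriv ?P0 y u = - b t * dir_deriv F y u" if "y \<in> B" for y t u
  proof -
    note y = B(3)[OF that]
    let ?E = "\<lambda>y. a t - (b t * dir_deriv F y (N y) + dir_deriv ?P0 y (N y))
      + (real DIM('e) - 1) * h y0 + b t * h y0 * F y"
    have smooth_along: "smooth_on (\<lambda>y. dir_deriv K y (N y)) S" if "smooth_on K S" for K :: "'e \<Rightarrow> real"
      using smooth_on_linear_family[where M = "dir_deriv K", OF open_domain
          linear_dir_deriv[OF smooth_on_differentiable[OF that]] smooth_on_dir_deriv[OF that]
          smooth_grad[OF smooth_function]] by blast
    have "(?E has_derivative (\<lambda>u. 0 - (b t * dir_deriv (\<lambda>y. dir_deriv F y (N y)) y u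
        + dir_deriv (\<lambda>y. dir_deriv ?P0 y (N y)) y u) + 0 + b t * h y0 * dir_deriv F y u)) (at y)"
      by (rule has_derivative_add[OF has_derivative_add[OF has_derivative_diff[OF has_derivative_const
            has_derivative_add[OF
              has_derivative_mult_right[OF smooth_on_has_derivative[OF smooth_along[OF smooth_function] y]]
              smooth_on_has_derivative[OF smooth_along[OF smooth_potential_slice] y]]]
          has_derivative_const] has_derivative_mult_right[OF smooth_on_has_derivative[OF smooth_function y]]])
    from dir_deriv_eq[OF this, of u] have "dir_deriv ?E y u = 0 - (b t * dir_deriv (\<lambda>y. dir_deriv F y (N y)) y u
        + dir_deriv (\<lambda>y. dir_deriv ?P0 y (N y)) y u) + 0 + b t * h y0 * dir_deriv F y u" .
    moreover have "dir_deriv ?E y = dir_deriv (\<lambda>_. 0::real) y"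
      by (rule dir_deriv_cong[OF B(1) that scalar])
    ultimately have "0 = 0 - (b t * dir_deriv (\<lambda>y. dir_deriv F y (N y)) y u
        + dir_deriv (\<lambda>y. dir_deriv ?P0 y (N y)) y u) + 0 + b t * h y0 * dir_deriv F y u"
      by (simp only: frechet_derivative_const)
    then have "h y0 * (dir_deriv ?P0 y u + b t * dir_deriv F y u) = 0"
      by (simp add: deriv_along_grad[OF smooth_function y] deriv_along_grad[OF smooth_potential_slice y]
          hessian_slice[OF y] hessian_eq[OF y] h[OF that] symmetric[OF y, of u "N y"]
          metric_grad[OF smooth_function y] algebra_simps)
    then show ?thesis using k by simp
  qed
  \<comment> \<open>\<open>key\<close> at time \<open>t0\<close>, where \<open>b\<close> vanishes\<close>
  have dP0: "dir_deriv ?P0 y u = 0" if "y \<in> B" for y u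
    using key[OF that, of u t0] by (simp add: b_def)
  \<comment> \<open>otherwise the Hessian \<open>h G\<close> of \<open>F\<close> would vanish at \<open>y0\<close>\<close>
  have "\<exists>y\<in>B. \<exists>u. dir_deriv F y u \<noteq> 0"
  proof (rule ccontr)
    assume "\<not> ?thesis"
    then have zero: "dir_deriv F y u = 0" if "y \<in> B" for y u using that by blast
    have "dir_deriv (\<lambda>y. dir_deriv F y u) y0 = dir_deriv (\<lambda>_. 0::real) y0" for u
      by (rule dir_deriv_cong[OF B(1,2) zero])
    then have "h y0 * G y0 u v = 0" for u v
      using hessian_eq[OF y0, of u v] zero[OF B(2)] by (simp add: coord_hessian_def)
    moreover obtain b' :: 'e where "b' \<in> Basis" using nonempty_Basis by blast
    ultimately show False using nondegenerate[OF y0, of b'] k nonzero_Basis by auto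
  qed
  then have b: "b t = 0" for t
    using key dP0 by fastforce
  have "P\<^sub>t (y0, t) = 0" for t
  proof -
    have "(\<lambda>t. P (y0, t)) = (\<lambda>t. ?P0 y0)"
      using P[OF B(2)] by (intro ext) (metis add_0 b mult_zero_right)
    then have "dir_deriv (\<lambda>t. P (y0, t)) t 1 = 0" by simp
    then show ?thesis
      using dir_deriv_eq[OF has_derivative_slice_snd[OF potential_diff[OF y0]]] by simp
  qed
  then have "dir_deriv (\<lambda>t. P\<^sub>t (y0, t)) t0 1 = 0" by simp
  then have "a t0 = 0"
    using dir_deriv_eq[OF has_derivative_slice_snd[OF time_deriv_diff[OF y0]]] by (simp add: a_def)
  then have "(real DIM('e) - 1) * h y0 = 0"
    using scalar[OF B(2), of t0] b dP0[OF B(2)] by simp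
  then show False using k dim by simp
qed

lemma static_ricci_zero: "y \<in> S \<Longrightarrow> coord_ricci Gt (y, t) V W = 0"
  by (simp add: static_ricci ricci_flat factor_zero)

end

section \<open>From charts to the manifold\<close>

lemma smooth_manifold_chart:
  assumes "smooth_manifold A"
  shows "open (chart_im (A i))" "q \<in> chart_dom (A i) \<Longrightarrow> chart_inv (A i) (coord (A i) q) = q"
  using assms unfolding smooth_manifold_def homeomorphism_def by blast+

lemma chart_inv_in: "y \<in> chart_im c \<Longrightarrow> chart_inv c y \<in> chart_dom c"
  unfolding chart_im_def chart_inv_def by (rule inv_into_into)

lemma coord_chart_inv: "y \<in> chart_im c \<Longrightarrow> coord c (chart_inv c y) = y"
  unfolding chart_im_def chart_inv_def by (rule f_inv_into_f)

lemma chart_im_static: "chart_im (static_atlas A i) = chart_im (A i) \<times> UNIV"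
  unfolding chart_im_def static_atlas_def by (auto simp: image_iff)

lemma chart_inv_static:
  assumes "smooth_manifold A" "y \<in> chart_im (A i)"
  shows "chart_inv (static_atlas A i) (y, t) = (chart_inv (A i) y, t)"
proof -
  have "inj_on (coord (A i)) (chart_dom (A i))"
    by (metis smooth_manifold_chart(2)[OF assms(1)] inj_on_inverseI)
  then have "inj_on (coord (static_atlas A i)) (chart_dom (static_atlas A i))"
    unfolding static_atlas_def by (simp add: map_prod_inj_on)
  then show ?thesis
    unfolding chart_inv_def
    by (rule inv_into_f_eq)
       (use chart_inv_in[OF assms(2)] coord_chart_inv[OF assms(2)]
         in \<open>simp_all add: static_atlas_def chart_inv_def\<close>)
qed

lemma metric_trace_zero:
  fixes k :: "'e::euclidean_space \<Rightarrow> 'e \<Rightarrow> real"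
  assumes "\<And>w. (\<And>z. k w z = 0) \<Longrightarrow> w = 0" "\<And>z. k 0 z = 0"
  shows "metric_trace k (\<lambda>_ _. 0) = 0"
proof -
  have "(THE w. \<forall>z. k w z = 0) = 0"
    using assms by (intro the_equality) blast+
  then show ?thesis by (simp add: metric_trace_def lin_trace_def)
qed

lemma coordinate_metric_chart:
  assumes A: "smooth_manifold A" and g: "riemannian_metric A g"
  shows "coordinate_metric (chart_im (A i)) (coord_metric A g i)"
proof
  note g' = g[unfolded riemannian_metric_def pseudo_riemannian_metric_def smooth_tensor2_def]
  show "open (chart_im (A i))" by (rule smooth_manifold_chart[OF A])
  show "smooth_on (\<lambda>y. coord_metric A g i y u v) (chart_im (A i))" for u v
    using g' unfolding coord_metric_def by blast
  fix y assume "y \<in> chart_im (A i)"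
  then have y: "chart_inv (A i) y \<in> chart_dom (A i)" by (rule chart_inv_in)
  show "bilinear (coord_metric A g i y)"
    using g' y unfolding coord_metric_def by blast
  show "coord_metric A g i y u v = coord_metric A g i y v u" for u v
    using g' y unfolding coord_metric_def by blast
  show "u = 0" if "\<And>v. coord_metric A g i y u v = 0" for u
    using g' y that unfolding coord_metric_def by blast
qed

lemma hessian_chart:
  assumes "y \<in> chart_im (A i)"
  shows "hessian A g F i (chart_inv (A i) y)
    = coord_hessian (coord_metric A g i) (F \<circ> chart_inv (A i)) y"
  using coord_chart_inv[OF assms] by (simp add: hessian_def)

lemma ricci_chart:
  assumes "y \<in> chart_im (A i)"
  shows "ricci A g i (chart_inv (A i) y) = coord_ricci (coord_metric A g i) y"
  using coord_chart_inv[OF assms] by (simp add: ricci_def)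

text \<open>Since the manifold is Ricci flat, its scalar curvature vanishes too, and the first fluid equation
  says that \<open>f\<close> is concircular with factor \<open>\<triangle>f / n\<close>. Representatives in the chart agree with the
  functions on the manifold only on the image of the chart, which is open; so their derivatives agree there.\<close>

lemma static_soliton_chart_of_spacetime:
  fixes A :: "('i, 'm::{t2_space, second_countable_topology}, 'e::euclidean_space) atlas"
  assumes dim: "2 \<le> DIM('e)" and A: "smooth_manifold A" and g: "riemannian_metric A g"
    and flat: "ricci_flat A g" and f: "smooth_function A f" "\<And>p. 0 < f p"
    and fluid: "static_perfect_fluid A g f rho"
    and soliton: "almost_gradient_ricci_soliton (static_atlas A) (static_metric g f) lam phi"
    and slice: "zero_tensor2 A (hessian A g (\<lambda>p. phi (p, t0)))"
  shows "static_soliton_chart (chart_im (A i)) (coord_metric A g i) (f \<circ> chart_inv (A i))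
    (\<lambda>y. laplacian A g f i (chart_inv (A i) y) / real DIM('e))
    (coord_metric (static_atlas A) (static_metric g f) i)
    (phi \<circ> chart_inv (static_atlas A i)) (lam \<circ> chart_inv (static_atlas A i)) t0"
proof -
  let ?S = "chart_im (A i)" and ?G = "coord_metric A g i"
  let ?Gt = "coord_metric (static_atlas A) (static_metric g f) i"
  interpret coordinate_metric ?S ?G by (rule coordinate_metric_chart[OF A g])
  have ricci: "ricci A g i p = (\<lambda>_ _. 0)" if "p \<in> chart_dom (A i)" for p
    using flat that by (auto simp: ricci_flat_def zero_tensor2_def fun_eq_iff)
  have scalar: "scalar_curvature A g i (chart_inv (A i) y) = 0" if "y \<in> ?S" for y
  proof -
    have "?G y w = g i (chart_inv (A i) y) w" for w by (simp add: coord_metric_def)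
    then show ?thesis
      unfolding scalar_curvature_def ricci[OF chart_inv_in[OF that]]
      using nondegenerate[OF that] linear_0[OF linear_left[OF that]]
      by (intro metric_trace_zero) auto
  qed
  show ?thesis
  proof unfold_locales
    show "smooth_on (f \<circ> chart_inv (A i)) ?S"
      using f(1) by (simp add: smooth_function_def)
    show "smooth_on (phi \<circ> chart_inv (static_atlas A i)) (?S \<times> UNIV)"
      using soliton by (simp add: almost_gradient_ricci_soliton_def smooth_function_def chart_im_static[symmetric])
    show "2 \<le> DIM('e)" by (rule dim)
    fix y assume y: "y \<in> ?S"
    note p = chart_inv_in[OF y]
    note static = chart_inv_static[OF A y]
    show "coord_hessian ?G (f \<circ> chart_inv (A i)) y u v
        = laplacian A g f i (chart_inv (A i) y) / real DIM('e) * ?G y u v" for u v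
    proof -
      have "f (chart_inv (A i) y) * (ricci A g i (chart_inv (A i) y) u v
          - scalar_curvature A g i (chart_inv (A i) y) / real DIM('e) * g i (chart_inv (A i) y) u v)
        = hessian A g f i (chart_inv (A i) y) u v
          - laplacian A g f i (chart_inv (A i) y) / real DIM('e) * g i (chart_inv (A i) y) u v"
        using fluid p by (simp add: static_perfect_fluid_def Let_def)
      then show ?thesis
        by (simp add: ricci[OF p] scalar[OF y] hessian_chart[where A = A and i = i, OF y] coord_metric_def)
    qed
    show "0 < (f \<circ> chart_inv (A i)) y" using f(2) by simp
    show "?Gt (y, t) U V = ?G y (fst U) (fst V) - ((f \<circ> chart_inv (A i)) y)\<^sup>2 * (snd U * snd V)" for t U V
      by (simp add: coord_metric_def static static_metric_def)
    show "coord_ricci ?G y u v = 0" for u v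
      using ricci[OF p] by (simp add: ricci_chart[where A = A and i = i, OF y, symmetric])
    show "coord_hessian ?Gt (phi \<circ> chart_inv (static_atlas A i)) (y, t) U V + coord_ricci ?Gt (y, t) U V
        + (lam \<circ> chart_inv (static_atlas A i)) (y, t) * ?Gt (y, t) U V = 0" for t U V
    proof -
      have yt: "(y, t) \<in> chart_im (static_atlas A i)" using y by (simp add: chart_im_static)
      let ?q = "chart_inv (static_atlas A i) (y, t)"
      have "hessian (static_atlas A) (static_metric g f) phi i ?q U V
          + ricci (static_atlas A) (static_metric g f) i ?q U V
          + lam ?q * static_metric g f i ?q U V = 0"
        using soliton chart_inv_in[OF yt]
        unfolding almost_gradient_ricci_soliton_def zero_tensor2_def by blast
      moreover have "?Gt (y, t) U V = static_metric g f i ?q U V"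
        by (simp only: coord_metric_def)
      ultimately show ?thesis
        by (simp only: hessian_chart[where A = "static_atlas A" and i = i, OF yt]
            ricci_chart[where A = "static_atlas A" and i = i, OF yt] o_apply)
    qed
    show "coord_hessian ?G (\<lambda>y. (phi \<circ> chart_inv (static_atlas A i)) (y, t0)) y u v = 0" for u v
    proof -
      have "coord_hessian ?G (\<lambda>y. (phi \<circ> chart_inv (static_atlas A i)) (y, t0)) y u v
        = coord_hessian ?G ((\<lambda>p. phi (p, t0)) \<circ> chart_inv (A i)) y u v"
        by (rule coord_hessian_cong[OF open_domain y]) (simp add: chart_inv_static[OF A])
      also have "\<dots> = 0"
        using slice p by (simp add: zero_tensor2_def hessian_chart[where A = A and i = i, OF y, symmetric])
      finally show ?thesis .
    qed
  qed
qed

theorem theorem4p3: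
  fixes A :: "('i, 'm::{t2_space, second_countable_topology}, 'e::euclidean_space) atlas"
    and g :: "('i, 'm, 'e) tensor2"
    and f rho :: "'m \<Rightarrow> real"
    and lam phi :: "'m \<times> real \<Rightarrow> real"
    and t0 :: real
  assumes "2 \<le> DIM('e)"
    and "smooth_manifold A"
    and "riemannian_metric A g"
    and "ricci_flat A g"
    and "smooth_function A f"
    and "\<And>p. 0 < f p"
    and "static_perfect_fluid A g f rho"
    and "almost_gradient_ricci_soliton (static_atlas A) (static_metric g f) lam phi"
    and "zero_tensor2 A (hessian A g (\<lambda>p. phi (p, t0)))"
    and "\<And>i p t. p \<in> chart_dom (A i) \<Longrightarrow>
           lam (p, t) \<le> scalar_curvature A g i p / (real DIM('e) - 1)"
  shows "strong_energy_condition (static_atlas A) (static_metric g f)"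
  unfolding strong_energy_condition_def
proof (intro allI ballI impI)
  fix i q and v :: "'e \<times> real"
  assume "q \<in> chart_dom (static_atlas A i)"
  then have q: "coord (A i) (fst q) \<in> chart_im (A i)"
    "coord (static_atlas A i) q = (coord (A i) (fst q), snd q)"
    by (auto simp: static_atlas_def chart_im_def mem_Times_iff map_prod_def split_beta)
  interpret static_soliton_chart "chart_im (A i)" "coord_metric A g i" "f \<circ> chart_inv (A i)"
    "\<lambda>y. laplacian A g f i (chart_inv (A i) y) / real DIM('e)"
    "coord_metric (static_atlas A) (static_metric g f) i"
    "phi \<circ> chart_inv (static_atlas A i)" "lam \<circ> chart_inv (static_atlas A i)" t0
    by (rule static_soliton_chart_of_spacetime[OF assms(1-9)])
  show "0 \<le> ricci (static_atlas A) (static_metric g f) i q v v"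
    using static_ricci_zero[OF q(1)] by (simp add: ricci_def q(2))
qed

end
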